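(* Let $\Delta=(\Delta^+,\Delta^-,\delta^* )$ be a thick twin building of type $(W,S)$ and let $\theta$ be an automorphism of $\Delta$ which interchanges the two halves $\Delta^+$ and $\Delta^-$. Then there is a spherical residue $R$ of $\Delta$ such that $R^\theta$ is opposite $R$.
   Context: $(W,S)$ is a Coxeter system with $S$ finite and $W$ irreducible; $\ell$ denotes length with respect to $S$, and $W_J$ is the subgroup generated by $J\subseteq S$. A twin building of type $(W,S)$ consists of two buildings $\Delta^+,\Delta^-$ of type $(W,S)$ (with $W$-distance $\delta$) and a codistance $\delta^*$ defined on pairs of chambers in different halves, such that for $\epsilon\in\{+,-\}$, $C\in\Delta^\epsilon$, $D\in\Delta^{-\epsilon}$, $w=\delta^*(C,D)$: (Tw1) $\delta^*(D,C)=w^{-1}$; (Tw2) if $E\in\Delta^{-\epsilon}$ with $\delta(D,E)=s\in S$ and $\ell(sw)=\ell(w)-1$ then $\delta^*(C,E)=sw$; (Tw3) for each $s\in S$ there is $E\in\Delta^{-\epsilon}$ with $\delta(D,E)=s$ and $\delta^*(C,E)=sw$. Chambers in the same half are adjacent if $\delta(C,D)\in S$. A $J$-residue ($J\subseteq S$) of $\Delta^\epsilon$ is a set $\{D\in\Delta^\epsilon:\delta(C,D)\in W_J\}$ for some $C\in\Delta^\epsilon$; it is spherical if $W_J$ is finite. Chambers $C,D$ in different halves are opposite if $\delta^*(C,D)=1$; residues $P,Q$ in different halves are opposite if every chamber of $P$ is opposite some chamber of $Q$. An automorphism is a bijection of the chamber set mapping adjacent chambers to adjacent chambers and preserving opposition.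 The twin building is thick if every panel ($\{s\}$-residue) has at least three chambers. *)

theory Defs
  imports "HOL-Algebra.Multiplicative_Group" "HOL-Algebra.Generated_Groups"
begin

definition word_prod :: "('w, 'm) monoid_scheme \<Rightarrow> 'w list \<Rightarrow> 'w" where
  "word_prod W ws = foldr (\<lambda>x y. x \<otimes>\<^bsub>W\<^esub> y) ws \<one>\<^bsub>W\<^esub>"

text \<open>
  The congruence on words over \<open>S\<close> generated by the relators \<open>(st)^m(s,t)\<close>, where \<open>m(s,t)\<close> is the
  order of \<open>st\<close> in \<open>W\<close>. The library assigns order \<open>0\<close> to elements of infinite order, so that
  \<open>m(s,t) = \<infinity>\<close> contributes no relation. The case \<open>s = t\<close> gives the relator \<open>ss\<close>, hence positive
  words suffice to present the group.
\<close>

inductive coxeter_cong :: "('w, 'm) monoid_scheme \<Rightarrow> 'w set \<Rightarrow> 'w list \<Rightarrow> 'w list \<Rightarrow> bool"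
  for W and S where
  refl: "u \<in> lists S \<Longrightarrow> coxeter_cong W S u u"
| sym: "coxeter_cong W S u v \<Longrightarrow> coxeter_cong W S v u"
| trans: "coxeter_cong W S u v \<Longrightarrow> coxeter_cong W S v w \<Longrightarrow> coxeter_cong W S u w"
| relator: "u \<in> lists S \<Longrightarrow> v \<in> lists S \<Longrightarrow> s \<in> S \<Longrightarrow> t \<in> S \<Longrightarrow>
    coxeter_cong W S (u @ concat (replicate (group.ord W (s \<otimes>\<^bsub>W\<^esub> t)) [s, t]) @ v) (u @ v)"

text \<open>\<open>W\<close> is presented by the involutions \<open>S\<close> subject to the relations \<open>(st)^m(s,t) = 1\<close>.\<close>

locale coxeter_system = group W for W :: "('w, 'm) monoid_scheme" (structure) +
  fixes S :: "'w set"
  assumes S_subset: "S \<subseteq> carrier W"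
    and S_generates: "generate W S = carrier W"
    and S_order_two: "s \<in> S \<Longrightarrow> group.ord W s = 2"
    and presentation: "u \<in> lists S \<Longrightarrow> v \<in> lists S \<Longrightarrow> word_prod W u = word_prod W v \<Longrightarrow>
      coxeter_cong W S u v"

definition cox_length :: "('w, 'm) monoid_scheme \<Rightarrow> 'w set \<Rightarrow> 'w \<Rightarrow> nat" where
  "cox_length W S w = (LEAST n. \<exists>ws \<in> lists S. length ws = n \<and> word_prod W ws = w)"

text \<open>
  Edges of the Coxeter diagram: pairs with \<open>m(s,t) \<ge> 3\<close> or \<open>m(s,t) = \<infinity>\<close>; the latter is order \<open>0\<close>.
\<close>

definition diagram_edges :: "('w, 'm) monoid_scheme \<Rightarrow> 'w set \<Rightarrow> ('w \<times> 'w) set" where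
  "diagram_edges W S = {(s, t). s \<in> S \<and> t \<in> S \<and> group.ord W (s \<otimes>\<^bsub>W\<^esub> t) \<notin> {1, 2}}"

definition irreducible_coxeter :: "('w, 'm) monoid_scheme \<Rightarrow> 'w set \<Rightarrow> bool" where
  "irreducible_coxeter W S \<longleftrightarrow>
     S \<noteq> {} \<and> (\<forall>s \<in> S. \<forall>t \<in> S. (s, t) \<in> (diagram_edges W S)\<^sup>*)"

locale building = coxeter_system W S for W :: "('w, 'm) monoid_scheme" (structure) and S +
  fixes Ch :: "'c set" and \<delta> :: "'c \<Rightarrow> 'c \<Rightarrow> 'w"
  assumes nonempty: "Ch \<noteq> {}"
    and dist_closed: "C \<in> Ch \<Longrightarrow> D \<in> Ch \<Longrightarrow> \<delta> C D \<in> carrier W"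
    and WD1: "C \<in> Ch \<Longrightarrow> D \<in> Ch \<Longrightarrow> \<delta> C D = \<one> \<longleftrightarrow> C = D"
    and WD2: "C \<in> Ch \<Longrightarrow> D \<in> Ch \<Longrightarrow> C' \<in> Ch \<Longrightarrow> s \<in> S \<Longrightarrow> \<delta> C' C = s \<Longrightarrow>
      \<delta> C' D \<in> {s \<otimes> \<delta> C D, \<delta> C D} \<and>
      (cox_length W S (s \<otimes> \<delta> C D) = cox_length W S (\<delta> C D) + 1 \<longrightarrow> \<delta> C' D = s \<otimes> \<delta> C D)"
    and WD3: "C \<in> Ch \<Longrightarrow> D \<in> Ch \<Longrightarrow> s \<in> S \<Longrightarrow>
      \<exists>C' \<in> Ch. \<delta> C' C = s \<and> \<delta> C' D = s \<otimes> \<delta> C D"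

datatype sign = Plus | Minus

fun opp_sign :: "sign \<Rightarrow> sign" where
  "opp_sign Plus = Minus"
| "opp_sign Minus = Plus"

text \<open>
  A single function \<open>\<delta>\<close> carries the Weyl distances of both (disjoint) halves; only its values on
  pairs of chambers in the same half matter, and only values of \<open>\<delta>s\<close> on pairs in different halves.
  The codistance is normalised so that moving its second argument multiplies on the left; this is
  the pointwise inverse of the other common convention.
\<close>

locale twin_building = coxeter_system W S for W :: "('w, 'm) monoid_scheme" (structure) and S +
  fixes \<Delta> :: "sign \<Rightarrow> 'c set"
    and \<delta> :: "'c \<Rightarrow> 'c \<Rightarrow> 'w"
    and \<delta>s :: "'c \<Rightarrow> 'c \<Rightarrow> 'w"
  assumes halves: "building W S (\<Delta> \<epsilon>) \<delta>"
    and disjoint_halves: "\<Delta> Plus \<inter> \<Delta> Minus = {}"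
    and codist_closed: "C \<in> \<Delta> \<epsilon> \<Longrightarrow> D \<in> \<Delta> (opp_sign \<epsilon>) \<Longrightarrow> \<delta>s C D \<in> carrier W"
    and Tw1: "C \<in> \<Delta> \<epsilon> \<Longrightarrow> D \<in> \<Delta> (opp_sign \<epsilon>) \<Longrightarrow> \<delta>s D C = inv (\<delta>s C D)"
    and Tw2: "C \<in> \<Delta> \<epsilon> \<Longrightarrow> D \<in> \<Delta> (opp_sign \<epsilon>) \<Longrightarrow> E \<in> \<Delta> (opp_sign \<epsilon>) \<Longrightarrow> s \<in> S \<Longrightarrow>
      \<delta> D E = s \<Longrightarrow> cox_length W S (s \<otimes> \<delta>s C D) + 1 = cox_length W S (\<delta>s C D) \<Longrightarrow>
      \<delta>s C E = s \<otimes> \<delta>s C D"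
    and Tw3: "C \<in> \<Delta> \<epsilon> \<Longrightarrow> D \<in> \<Delta> (opp_sign \<epsilon>) \<Longrightarrow> s \<in> S \<Longrightarrow>
      \<exists>E \<in> \<Delta> (opp_sign \<epsilon>). \<delta> D E = s \<and> \<delta>s C E = s \<otimes> \<delta>s C D"

definition adjacent ::
  "'w set \<Rightarrow> (sign \<Rightarrow> 'c set) \<Rightarrow> ('c \<Rightarrow> 'c \<Rightarrow> 'w) \<Rightarrow> 'c \<Rightarrow> 'c \<Rightarrow> bool" where
  "adjacent S \<Delta> \<delta> C D \<longleftrightarrow> (\<exists>\<epsilon>. C \<in> \<Delta> \<epsilon> \<and> D \<in> \<Delta> \<epsilon> \<and> \<delta> C D \<in> S)"

definition residue_of_type ::
  "('w, 'm) monoid_scheme \<Rightarrow> (sign \<Rightarrow> 'c set) \<Rightarrow> ('c \<Rightarrow> 'c \<Rightarrow> 'w) \<Rightarrow> sign \<Rightarrow> 'w set \<Rightarrow> 'c set \<Rightarrow> bool"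
  where
  "residue_of_type W \<Delta> \<delta> \<epsilon> J R \<longleftrightarrow> (\<exists>C \<in> \<Delta> \<epsilon>. R = {D \<in> \<Delta> \<epsilon>. \<delta> C D \<in> generate W J})"

definition residue_in ::
  "('w, 'm) monoid_scheme \<Rightarrow> 'w set \<Rightarrow> (sign \<Rightarrow> 'c set) \<Rightarrow> ('c \<Rightarrow> 'c \<Rightarrow> 'w) \<Rightarrow> sign \<Rightarrow> 'c set \<Rightarrow> bool"
  where
  "residue_in W S \<Delta> \<delta> \<epsilon> R \<longleftrightarrow> (\<exists>J. J \<subseteq> S \<and> residue_of_type W \<Delta> \<delta> \<epsilon> J R)"

definition spherical_residue ::
  "('w, 'm) monoid_scheme \<Rightarrow> 'w set \<Rightarrow> (sign \<Rightarrow> 'c set) \<Rightarrow> ('c \<Rightarrow> 'c \<Rightarrow> 'w) \<Rightarrow> 'c set \<Rightarrow> bool" where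
  "spherical_residue W S \<Delta> \<delta> R \<longleftrightarrow>
     (\<exists>\<epsilon> J. J \<subseteq> S \<and> finite (generate W J) \<and> residue_of_type W \<Delta> \<delta> \<epsilon> J R)"

definition opposite ::
  "('w, 'm) monoid_scheme \<Rightarrow> (sign \<Rightarrow> 'c set) \<Rightarrow> ('c \<Rightarrow> 'c \<Rightarrow> 'w) \<Rightarrow> 'c \<Rightarrow> 'c \<Rightarrow> bool" where
  "opposite W \<Delta> \<delta>s C D \<longleftrightarrow> (\<exists>\<epsilon>. C \<in> \<Delta> \<epsilon> \<and> D \<in> \<Delta> (opp_sign \<epsilon>) \<and> \<delta>s C D = \<one>\<^bsub>W\<^esub>)"

definition opposite_residues ::
  "('w, 'm) monoid_scheme \<Rightarrow> 'w set \<Rightarrow> (sign \<Rightarrow> 'c set) \<Rightarrow> ('c \<Rightarrow> 'c \<Rightarrow> 'w) \<Rightarrow> ('c \<Rightarrow> 'c \<Rightarrow> 'w) \<Rightarrow>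
   'c set \<Rightarrow> 'c set \<Rightarrow> bool" where
  "opposite_residues W S \<Delta> \<delta> \<delta>s P Q \<longleftrightarrow>
     (\<exists>\<epsilon>. residue_in W S \<Delta> \<delta> \<epsilon> P \<and> residue_in W S \<Delta> \<delta> (opp_sign \<epsilon>) Q) \<and>
     (\<forall>C \<in> P. \<exists>D \<in> Q. opposite W \<Delta> \<delta>s C D)"

definition thick ::
  "('w, 'm) monoid_scheme \<Rightarrow> 'w set \<Rightarrow> (sign \<Rightarrow> 'c set) \<Rightarrow> ('c \<Rightarrow> 'c \<Rightarrow> 'w) \<Rightarrow> bool" where
  "thick W S \<Delta> \<delta> \<longleftrightarrow>
     (\<forall>\<epsilon> s P. s \<in> S \<longrightarrow> residue_of_type W \<Delta> \<delta> \<epsilon> {s} P \<longrightarrow> infinite P \<or> card P \<ge> 3)"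

definition twin_automorphism ::
  "('w, 'm) monoid_scheme \<Rightarrow> 'w set \<Rightarrow> (sign \<Rightarrow> 'c set) \<Rightarrow> ('c \<Rightarrow> 'c \<Rightarrow> 'w) \<Rightarrow> ('c \<Rightarrow> 'c \<Rightarrow> 'w) \<Rightarrow>
   ('c \<Rightarrow> 'c) \<Rightarrow> bool" where
  "twin_automorphism W S \<Delta> \<delta> \<delta>s \<theta> \<longleftrightarrow>
     bij_betw \<theta> (\<Union>\<epsilon>. \<Delta> \<epsilon>) (\<Union>\<epsilon>. \<Delta> \<epsilon>) \<and>
     (\<forall>C \<in> (\<Union>\<epsilon>. \<Delta> \<epsilon>). \<forall>D \<in> (\<Union>\<epsilon>. \<Delta> \<epsilon>).
        (adjacent S \<Delta> \<delta> C D \<longrightarrow> adjacent S \<Delta> \<delta> (\<theta> C) (\<theta> D)) \<and>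
        (opposite W \<Delta> \<delta>s C D \<longleftrightarrow> opposite W \<Delta> \<delta>s (\<theta> C) (\<theta> D)))"

end

theory Submission
  imports Defs
begin

text \<open>
  Choose a chamber \<open>C\<close> for which \<open>w = \<delta>s C (\<theta> C)\<close> has minimal length. Opposition detects panels and
  their types, so \<open>\<theta>\<close> maps \<open>s\<close>-panels onto \<open>\<sigma> s\<close>-panels for a permutation \<open>\<sigma>\<close> of \<open>S\<close>. Comparing \<open>C\<close>
  with the other chambers of its \<open>s\<close>-panel, of which there are at least two, minimality forces
  \<open>\<sigma> s w = w s\<close> whenever \<open>s\<close> is a right descent or \<open>\<sigma> s\<close> a left descent of \<open>w\<close>. Conjugation by \<open>w\<close>
  therefore maps the set \<open>K\<close> of right descents onto the set \<open>J\<close> of left descents. A minimal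
  representative of the coset \<open>W\<^sub>J w\<close> can have no right descent, so \<open>w \<in> W\<^sub>J\<close>, and similarly \<open>w \<in> W\<^sub>K\<close>;
  hence \<open>J = K\<close>, and \<open>W\<^sub>J\<close> is finite because \<open>J\<close> consists of descents of \<open>w\<close>. The \<open>J\<close>-residue of \<open>C\<close>
  is then opposite its image, the \<open>J\<close>-residue of \<open>\<theta> C\<close>.
\<close>

section \<open>The exchange condition\<close>

text \<open>
  The number of \<open>i\<close> with \<open>t = s\<^sub>1 \<dots> s\<^sub>i \<dots> s\<^sub>1\<close> for the word \<open>s\<^sub>1 \<dots> s\<^sub>k\<close>. Its parity depends only on the
  product of the word, which yields the exchange condition from the presentation.
\<close>

primrec reflection_count :: "('w, 'm) monoid_scheme \<Rightarrow> 'w list \<Rightarrow> 'w \<Rightarrow> nat" where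
  "reflection_count W [] t = 0"
| "reflection_count W (s # ws) t = (if t = s then 1 else 0) + reflection_count W ws (s \<otimes>\<^bsub>W\<^esub> t \<otimes>\<^bsub>W\<^esub> s)"

primrec alternating_word :: "nat \<Rightarrow> 'a \<Rightarrow> 'a \<Rightarrow> 'a list" where
  "alternating_word 0 s t = []"
| "alternating_word (Suc k) s t = s # alternating_word k t s"

lemma concat_replicate_pair: "concat (replicate k [s, t]) = alternating_word (2 * k) s t"
  by (induction k) auto

lemma alternating_word_in_lists: "s \<in> A \<Longrightarrow> t \<in> A \<Longrightarrow> alternating_word k s t \<in> lists A"
  by (induction k arbitrary: s t) auto

lemma (in monoid) mult_nat_pow_swap:
  assumes "x \<in> carrier G" "y \<in> carrier G"
  shows "x \<otimes> (y \<otimes> x) [^] k = (x \<otimes> y) [^] (k::nat) \<otimes> x"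
proof (induction k)
  case (Suc k)
  have "x \<otimes> (y \<otimes> x) [^] Suc k = x \<otimes> (y \<otimes> x) [^] k \<otimes> (y \<otimes> x)"
    using assms by (simp add: m_assoc)
  also have "\<dots> = (x \<otimes> y) [^] Suc k \<otimes> x"
    unfolding Suc using assms by (simp add: m_assoc)
  finally show ?case .
qed (use assms in simp)

lemma (in group) inv_mult_cancel_left [simp]:
  "x \<in> carrier G \<Longrightarrow> y \<in> carrier G \<Longrightarrow> inv x \<otimes> (x \<otimes> y) = y"
  by (simp flip: m_assoc)

lemma (in group) mult_inv_cancel_left [simp]:
  "x \<in> carrier G \<Longrightarrow> y \<in> carrier G \<Longrightarrow> x \<otimes> (inv x \<otimes> y) = y"
  by (simp flip: m_assoc)

context coxeter_system
begin

abbreviation wprod :: "'w list \<Rightarrow> 'w" where "wprod \<equiv> word_prod W"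
abbreviation cox_len :: "'w \<Rightarrow> nat" ("\<ell>") where "\<ell> \<equiv> cox_length W S"
abbreviation parabolic :: "'w set \<Rightarrow> 'w set" where "parabolic \<equiv> generate W"

lemma word_prod_Nil [simp]: "wprod [] = \<one>"
  by (simp add: word_prod_def)

lemma word_prod_Cons [simp]: "wprod (x # xs) = x \<otimes> wprod xs"
  by (simp add: word_prod_def)

lemma generator_closed [simp, intro]: "s \<in> S \<Longrightarrow> s \<in> carrier W"
  using S_subset by blast

lemma word_prod_closed [simp, intro]: "ws \<in> lists S \<Longrightarrow> wprod ws \<in> carrier W"
  by (induction ws) auto

lemma word_prod_append: "us \<in> lists S \<Longrightarrow> vs \<in> lists S \<Longrightarrow> wprod (us @ vs) = wprod us \<otimes> wprod vs"
  by (induction us) (auto simp: m_assoc)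

lemma generator_square [simp]: "s \<in> S \<Longrightarrow> s \<otimes> s = \<one>"
  using pow_ord_eq_1[of s] S_order_two[of s] by (simp add: numeral_2_eq_2)

lemma generator_inv [simp]: "s \<in> S \<Longrightarrow> inv s = s"
  by (intro inv_equality) auto

lemma generator_neq_one: "s \<in> S \<Longrightarrow> s \<noteq> \<one>"
  using S_order_two ord_eq_1 by fastforce

lemma generator_cancel_left [simp]: "s \<in> S \<Longrightarrow> x \<in> carrier W \<Longrightarrow> s \<otimes> (s \<otimes> x) = x"
  by (simp flip: m_assoc)

lemma generator_cancel_right [simp]: "s \<in> S \<Longrightarrow> x \<in> carrier W \<Longrightarrow> x \<otimes> s \<otimes> s = x"
  by (simp add: m_assoc)

lemma generator_mult_eq_iff: "s \<in> S \<Longrightarrow> x \<in> carrier W \<Longrightarrow> y \<in> carrier W \<Longrightarrow> s \<otimes> x = y \<longleftrightarrow> x = s \<otimes> y"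
  by auto

lemma mult_generator_eq_iff: "s \<in> S \<Longrightarrow> x \<in> carrier W \<Longrightarrow> y \<in> carrier W \<Longrightarrow> x \<otimes> s = y \<longleftrightarrow> x = y \<otimes> s"
  by auto

lemma word_prod_rev: "ws \<in> lists S \<Longrightarrow> wprod (rev ws) = inv (wprod ws)"
proof (induction ws)
  case (Cons s ws)
  then have "rev ws \<in> lists S" by (simp add: in_lists_conv_set)
  with Cons show ?case by (simp add: word_prod_append inv_mult_group)
qed simp

lemma word_prod_alternating:
  "s \<in> S \<Longrightarrow> t \<in> S \<Longrightarrow> wprod (alternating_word (2 * k) s t) = (s \<otimes> t) [^] k"
proof (induction k)
  case (Suc k)
  then show ?case using nat_pow_Suc2[of "s \<otimes> t" k] by (simp add: m_assoc del: nat_pow_Suc)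
qed simp

lemma reflection_count_append:
  assumes "u \<in> lists S" "v \<in> lists S" "t \<in> carrier W"
  shows "reflection_count W (u @ v) t =
    reflection_count W u t + reflection_count W v (inv (wprod u) \<otimes> t \<otimes> wprod u)"
  using assms
proof (induction u arbitrary: t)
  case (Cons s u)
  then show ?case by (simp add: inv_mult_group m_assoc)
qed simp

lemma reflection_count_alternating:
  assumes "s \<in> S" "t \<in> S" "r \<in> carrier W"
  shows "reflection_count W (alternating_word k s t) r =
    (\<Sum>i<k. if r = (s \<otimes> t) [^] i \<otimes> s then 1 else 0)"
  using assms
proof (induction k arbitrary: s t r)
  case (Suc k)
  have shift: "s \<otimes> r \<otimes> s = (t \<otimes> s) [^] i \<otimes> t \<longleftrightarrow> r = (s \<otimes> t) [^] Suc i \<otimes> s" for i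
  proof -
    have "s \<otimes> r \<otimes> s = (t \<otimes> s) [^] i \<otimes> t \<longleftrightarrow> r = s \<otimes> ((t \<otimes> s) [^] i \<otimes> t \<otimes> s)"
      using Suc.prems by (simp add: generator_mult_eq_iff mult_generator_eq_iff)
    also have "s \<otimes> ((t \<otimes> s) [^] i \<otimes> t \<otimes> s) = s \<otimes> (t \<otimes> s) [^] Suc i"
      using Suc.prems by (simp add: m_assoc)
    finally show ?thesis using Suc.prems by (simp only: mult_nat_pow_swap generator_closed)
  qed
  have "reflection_count W (alternating_word (Suc k) s t) r
      = (if r = s then 1 else 0) + (\<Sum>i<k. if s \<otimes> r \<otimes> s = (t \<otimes> s) [^] i \<otimes> t then 1 else 0)"
    using Suc.IH[of t s "s \<otimes> r \<otimes> s"] Suc.prems by simp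
  also have "\<dots> = (\<Sum>i<Suc k. if r = (s \<otimes> t) [^] i \<otimes> s then 1 else 0)"
    unfolding sum.lessThan_Suc_shift shift using Suc.prems by simp
  finally show ?case .
qed simp

lemma even_reflection_count_relator:
  assumes "s \<in> S" "t \<in> S" "r \<in> carrier W"
  shows "even (reflection_count W (alternating_word (2 * ord (s \<otimes> t)) s t) r)"
proof -
  define m where "m = ord (s \<otimes> t)"
  define hit where "hit i = (if r = (s \<otimes> t) [^] i \<otimes> s then 1 else 0 :: nat)" for i :: nat
  have period: "hit (i + m) = hit i" for i
    unfolding hit_def m_def using assms by (simp flip: nat_pow_mult)
  have "(\<Sum>i<2*m. hit i) = (\<Sum>i<m. hit i) + (\<Sum>i=m..<m+m. hit i)"
    by (simp add: lessThan_atLeast0 sum.atLeastLessThan_concat mult_2)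
  also have "(\<Sum>i=m..<m+m. hit i) = (\<Sum>i<m. hit i)"
    using sum.shift_bounds_nat_ivl[of hit 0 m m] period by (simp add: lessThan_atLeast0)
  finally show ?thesis
    unfolding reflection_count_alternating[OF assms] m_def[symmetric] hit_def by simp
qed

lemma even_reflection_count_insert:
  assumes words: "u \<in> lists S" "r \<in> lists S" "v \<in> lists S" and t: "t \<in> carrier W"
    and one: "wprod r = \<one>" and even: "\<And>x. x \<in> carrier W \<Longrightarrow> even (reflection_count W r x)"
  shows "even (reflection_count W (u @ r @ v) t) \<longleftrightarrow> even (reflection_count W (u @ v) t)"
proof -
  define x where "x = inv (wprod u) \<otimes> t \<otimes> wprod u"
  have x: "x \<in> carrier W" unfolding x_def using words t by simp
  have "reflection_count W (u @ r @ v) t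
      = reflection_count W u t + (reflection_count W r x + reflection_count W v x)"
    using words t x one by (simp add: reflection_count_append flip: x_def)
  moreover have "reflection_count W (u @ v) t = reflection_count W u t + reflection_count W v x"
    using words t by (simp add: reflection_count_append x_def)
  ultimately show ?thesis using even[OF x] by simp
qed

lemma coxeter_cong_reflection_count:
  assumes "coxeter_cong W S u v" "t \<in> carrier W"
  shows "even (reflection_count W u t) \<longleftrightarrow> even (reflection_count W v t)"
  using assms
proof induction
  case (relator u v r s)
  then show ?case
    unfolding concat_replicate_pair
    by (intro even_reflection_count_insert)
      (auto simp: alternating_word_in_lists word_prod_alternating even_reflection_count_relator)
qed auto

lemma reflection_count_deletion:
  assumes "ws \<in> lists S" "t \<in> carrier W" "reflection_count W ws t \<noteq> 0"
  shows "\<exists>a x b. ws = a @ x # b \<and> t \<otimes> wprod ws = wprod (a @ b)"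
  using assms
proof (induction ws arbitrary: t)
  case (Cons s ws)
  show ?case
  proof (cases "t = s")
    case True
    then have "s # ws = [] @ s # ws \<and> t \<otimes> wprod (s # ws) = wprod ([] @ ws)" using Cons by simp
    then show ?thesis by blast
  next
    case False
    with Cons.hyps Cons.prems have "ws \<in> lists S" "s \<otimes> t \<otimes> s \<in> carrier W"
      "reflection_count W ws (s \<otimes> t \<otimes> s) \<noteq> 0"
      by simp_all
    then obtain a x b where ab: "ws = a @ x # b" "s \<otimes> t \<otimes> s \<otimes> wprod ws = wprod (a @ b)"
      using Cons.IH by blast
    have "s \<otimes> (s \<otimes> t \<otimes> s \<otimes> wprod ws) = t \<otimes> (s \<otimes> wprod ws)"
      using Cons.hyps Cons.prems by (simp add: m_assoc)
    then have "s # ws = (s # a) @ x # b \<and> t \<otimes> wprod (s # ws) = wprod ((s # a) @ b)" using ab by simp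
    then show ?thesis by blast
  qed
qed simp

lemma parabolic_eq_word_prods:
  assumes "J \<subseteq> S" shows "parabolic J = wprod ` lists J"
proof
  show "parabolic J \<subseteq> wprod ` lists J"
  proof
    fix x assume "x \<in> parabolic J"
    then show "x \<in> wprod ` lists J"
    proof induction
      case one
      show ?case by (rule image_eqI[of _ _ "[]"]) auto
    next
      case (incl s)
      with assms show ?case by (intro image_eqI[of _ _ "[s]"]) auto
    next
      case (inv s)
      with assms have "inv s = s" by auto
      with inv assms show ?case by (intro image_eqI[of _ _ "[s]"]) auto
    next
      case (eng x y)
      then obtain u v where "u \<in> lists J" "v \<in> lists J" "x = wprod u" "y = wprod v" by auto
      moreover from this have "wprod (u @ v) = wprod u \<otimes> wprod v"
        using word_prod_append lists_mono[OF assms] by blast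
      ultimately show ?case by (intro image_eqI[of _ _ "u @ v"]) auto
    qed
  qed
  show "wprod ` lists J \<subseteq> parabolic J"
  proof
    fix x assume "x \<in> wprod ` lists J"
    then obtain ws where "ws \<in> lists J" "x = wprod ws" by auto
    then show "x \<in> parabolic J"
      by (induction ws arbitrary: x) (auto intro: generate.intros)
  qed
qed

lemma reduced_word_exists:
  assumes "w \<in> carrier W"
  obtains ws where "ws \<in> lists S" "wprod ws = w" "length ws = \<ell> w"
proof -
  obtain us where "us \<in> lists S" "wprod us = w"
    using assms parabolic_eq_word_prods[of S] S_generates by auto
  then have "\<exists>ws \<in> lists S. length ws = length us \<and> wprod ws = w" by auto
  then have "\<exists>ws \<in> lists S. length ws = \<ell> w \<and> wprod ws = w"
    unfolding cox_length_def by (rule LeastI)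
  then show thesis using that by blast
qed

lemma cox_length_word_prod_le: "ws \<in> lists S \<Longrightarrow> \<ell> (wprod ws) \<le> length ws"
  unfolding cox_length_def by (rule Least_le) auto

lemma cox_length_one [simp]: "\<ell> \<one> = 0"
  using cox_length_word_prod_le[of "[]"] by simp

lemma cox_length_eq_0_iff: "w \<in> carrier W \<Longrightarrow> \<ell> w = 0 \<longleftrightarrow> w = \<one>"
  by (metis cox_length_one length_0_conv reduced_word_exists word_prod_Nil)

lemma cox_length_mult_le:
  assumes "x \<in> carrier W" "y \<in> carrier W" shows "\<ell> (x \<otimes> y) \<le> \<ell> x + \<ell> y"
proof -
  obtain us where "us \<in> lists S" "wprod us = x" "length us = \<ell> x"
    using reduced_word_exists[OF assms(1)] .
  moreover obtain vs where "vs \<in> lists S" "wprod vs = y" "length vs = \<ell> y"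
    using reduced_word_exists[OF assms(2)] .
  ultimately show ?thesis
    using cox_length_word_prod_le[of "us @ vs"] by (simp add: word_prod_append)
qed

lemma cox_length_inv: assumes "w \<in> carrier W" shows "\<ell> (inv w) = \<ell> w"
proof -
  have le: "\<ell> (inv v) \<le> \<ell> v" if "v \<in> carrier W" for v
  proof -
    obtain ws where "ws \<in> lists S" "wprod ws = v" "length ws = \<ell> v"
      using reduced_word_exists[OF \<open>v \<in> carrier W\<close>] .
    then show ?thesis
      using cox_length_word_prod_le[of "rev ws"] by (auto simp: word_prod_rev in_lists_conv_set)
  qed
  show ?thesis using le[of w] le[of "inv w"] assms by simp
qed

lemma cox_length_less_if_odd_reflection_count:
  assumes s: "s \<in> S" and ws: "ws \<in> lists S" and odd: "odd (reflection_count W ws s)"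
  shows "\<ell> (s \<otimes> wprod ws) < \<ell> (wprod ws)"
proof -
  obtain rs where rs: "rs \<in> lists S" "wprod rs = wprod ws" "length rs = \<ell> (wprod ws)"
    using reduced_word_exists[OF word_prod_closed[OF ws]] .
  have "odd (reflection_count W rs s)"
    using coxeter_cong_reflection_count[OF presentation[OF rs(1) ws rs(2)]] s odd by blast
  then have "reflection_count W rs s \<noteq> 0" by (metis even_zero)
  then obtain a x b where "rs = a @ x # b" "s \<otimes> wprod rs = wprod (a @ b)"
    using reflection_count_deletion[OF rs(1)] s by blast
  then show ?thesis using rs cox_length_word_prod_le[of "a @ b"] by auto
qed

lemma generator_mult_descent_iff:
  assumes "s \<in> S" "ws \<in> lists S"
  shows "\<ell> (s \<otimes> wprod ws) < \<ell> (wprod ws) \<longleftrightarrow> odd (reflection_count W ws s)"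
  using cox_length_less_if_odd_reflection_count[of s ws]
    cox_length_less_if_odd_reflection_count[of s "s # ws"] assms by auto

lemma cox_length_generator_mult:
  assumes "s \<in> S" "w \<in> carrier W"
  obtains (ascent) "\<ell> (s \<otimes> w) = \<ell> w + 1" | (descent) "\<ell> (s \<otimes> w) + 1 = \<ell> w"
proof -
  have le: "\<ell> (s \<otimes> v) \<le> \<ell> v + 1" if "v \<in> carrier W" for v
    using cox_length_mult_le[of s v] cox_length_word_prod_le[of "[s]"] assms(1) that by simp
  obtain ws where ws: "ws \<in> lists S" "wprod ws = w" using reduced_word_exists[OF assms(2)] .
  have "\<ell> (s \<otimes> w) < \<ell> w \<or> \<ell> w < \<ell> (s \<otimes> w)"
    using generator_mult_descent_iff[OF assms(1), of ws]
      generator_mult_descent_iff[OF assms(1), of "s # ws"] assms ws by auto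
  then show thesis using le[of w] le[of "s \<otimes> w"] that assms by fastforce
qed

lemma exchange:
  assumes "s \<in> S" "ws \<in> lists S" "\<ell> (s \<otimes> wprod ws) < \<ell> (wprod ws)"
  obtains a x b where "ws = a @ x # b" "s \<otimes> wprod ws = wprod (a @ b)"
proof -
  have "reflection_count W ws s \<noteq> 0" using generator_mult_descent_iff assms by (metis even_zero)
  then show thesis using that reflection_count_deletion assms by blast
qed

lemma exchange_mult:
  assumes s: "s \<in> S" and x: "x \<in> carrier W" and y: "y \<in> carrier W"
    and descent: "\<ell> (s \<otimes> (x \<otimes> y)) < \<ell> (x \<otimes> y)"
  obtains (left) "\<ell> (s \<otimes> x) < \<ell> x"
    | (right) z where "z \<in> carrier W" "\<ell> z < \<ell> y" "s \<otimes> (x \<otimes> y) = x \<otimes> z"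
proof -
  obtain us where us: "us \<in> lists S" "wprod us = x" "length us = \<ell> x"
    using reduced_word_exists[OF x] .
  obtain vs where vs: "vs \<in> lists S" "wprod vs = y" "length vs = \<ell> y"
    using reduced_word_exists[OF y] .
  have xy: "wprod (us @ vs) = x \<otimes> y" using word_prod_append us vs by simp
  obtain a r b where ab: "us @ vs = a @ r # b" "s \<otimes> (x \<otimes> y) = wprod (a @ b)"
    using exchange[OF s, of "us @ vs"] us(1) vs(1) descent by (metis append_in_lists_conv xy)
  consider (in_us) c where "us = a @ r # c" "b = c @ vs"
    | (in_vs) c where "a = us @ c" "vs = c @ r # b"
    using ab(1) by (auto simp: append_eq_append_conv2 append_eq_Cons_conv Cons_eq_append_conv)
  then show thesis
  proof cases
    case in_us
    then have ac: "a @ c \<in> lists S" using us by auto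
    have "s \<otimes> x \<otimes> y = wprod (a @ c) \<otimes> y"
      using ab(2) in_us s x y vs word_prod_append[OF ac vs(1)] by (simp add: m_assoc)
    then have "s \<otimes> x = wprod (a @ c)" using s x y word_prod_closed[OF ac] by simp
    then show thesis using left cox_length_word_prod_le[OF ac] in_us us by simp
  next
    case in_vs
    then have cb: "c @ b \<in> lists S" using vs by auto
    have "s \<otimes> (x \<otimes> y) = x \<otimes> wprod (c @ b)"
      using ab(2) in_vs us word_prod_append[OF us(1) cb] by simp
    then show thesis
      using right[of "wprod (c @ b)"] cox_length_word_prod_le[OF cb] in_vs vs cb by auto
  qed
qed

section \<open>Descents and parabolic subgroups\<close>

definition left_descents :: "'w \<Rightarrow> 'w set" where
  "left_descents w = {s \<in> S. \<ell> (s \<otimes> w) < \<ell> w}"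

definition right_descents :: "'w \<Rightarrow> 'w set" where
  "right_descents w = {s \<in> S. \<ell> (w \<otimes> s) < \<ell> w}"

lemma left_descents_subset: "left_descents w \<subseteq> S"
  unfolding left_descents_def by blast

lemma right_descents_subset: "right_descents w \<subseteq> S"
  unfolding right_descents_def by blast

lemma cox_length_mult_generator:
  assumes "s \<in> S" "w \<in> carrier W" shows "\<ell> (w \<otimes> s) = \<ell> (s \<otimes> inv w)"
  using cox_length_inv[of "w \<otimes> s"] assms by (simp add: inv_mult_group)

lemma left_descents_inv: "w \<in> carrier W \<Longrightarrow> left_descents (inv w) = right_descents w"
  unfolding left_descents_def right_descents_def
  by (auto simp: cox_length_mult_generator cox_length_inv)

lemma right_descents_inv: "w \<in> carrier W \<Longrightarrow> right_descents (inv w) = left_descents w"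
  using left_descents_inv[of "inv w"] by simp

lemma left_descent_iff:
  assumes "s \<in> S" "w \<in> carrier W" shows "s \<in> left_descents w \<longleftrightarrow> \<ell> (s \<otimes> w) + 1 = \<ell> w"
  using assms(1) unfolding left_descents_def
  by (cases rule: cox_length_generator_mult[OF assms]) auto

lemma left_ascent_iff:
  assumes "s \<in> S" "w \<in> carrier W" shows "s \<notin> left_descents w \<longleftrightarrow> \<ell> (s \<otimes> w) = \<ell> w + 1"
  using assms(1) unfolding left_descents_def
  by (cases rule: cox_length_generator_mult[OF assms]) auto

lemma right_ascent_iff:
  "s \<in> S \<Longrightarrow> w \<in> carrier W \<Longrightarrow> s \<notin> right_descents w \<longleftrightarrow> \<ell> (w \<otimes> s) = \<ell> w + 1"
  using left_ascent_iff[of s "inv w"]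
  by (simp add: left_descents_inv cox_length_mult_generator cox_length_inv)

lemma left_descents_generator_mult:
  assumes "s \<in> S" "w \<in> carrier W"
  shows "s \<in> left_descents (s \<otimes> w) \<longleftrightarrow> s \<notin> left_descents w"
  using assms(1) generator_cancel_left[OF assms] unfolding left_descents_def
  by (cases rule: cox_length_generator_mult[OF assms]) auto

lemma cox_length_generator: "s \<in> S \<Longrightarrow> \<ell> s = 1"
  by (rule cox_length_generator_mult[of s \<one>]) auto

lemma left_descents_generator: "s \<in> S \<Longrightarrow> s \<in> left_descents s"
  by (simp add: left_descents_def cox_length_generator)

lemma right_descents_generator: "s \<in> S \<Longrightarrow> s \<in> right_descents s"
  by (simp add: right_descents_def cox_length_generator)

lemma left_descents_nonempty:
  assumes "w \<in> carrier W" "w \<noteq> \<one>" shows "left_descents w \<noteq> {}"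
proof -
  obtain ws where ws: "ws \<in> lists S" "wprod ws = w" "length ws = \<ell> w"
    using reduced_word_exists[OF assms(1)] .
  then obtain s us where "ws = s # us" using assms(2) by (cases ws) auto
  with ws have s: "s \<in> S" and us: "us \<in> lists S" "w = s \<otimes> wprod us" "\<ell> w = Suc (length us)" by auto
  then have "\<ell> (s \<otimes> w) < \<ell> w" using cox_length_word_prod_le[of us] by simp
  then show ?thesis using s unfolding left_descents_def by blast
qed

lemma cox_length_two_sided_ascent:
  assumes s: "s \<in> S" and t: "t \<in> S" and w: "w \<in> carrier W"
    and ascents: "s \<notin> left_descents w" "t \<notin> right_descents w" and neq: "s \<otimes> w \<noteq> w \<otimes> t"
  shows "\<ell> (s \<otimes> w \<otimes> t) = \<ell> w + 2"
proof -
  have "s \<notin> left_descents (w \<otimes> t)"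
  proof
    assume "s \<in> left_descents (w \<otimes> t)"
    then have descent: "\<ell> (s \<otimes> (w \<otimes> t)) < \<ell> (w \<otimes> t)" unfolding left_descents_def by blast
    from s w generator_closed[OF t] descent show False
    proof (cases rule: exchange_mult)
      case left
      then show False using ascents(1) s unfolding left_descents_def by blast
    next
      case (right z)
      then have "s \<otimes> (w \<otimes> t) = w"
        using t w by (simp add: cox_length_generator cox_length_eq_0_iff)
      then show False using neq s t w by (simp add: mult_generator_eq_iff flip: m_assoc)
    qed
  qed
  then show ?thesis using ascents(2) s t w by (simp add: left_ascent_iff right_ascent_iff m_assoc)
qed

lemma right_descent_of_left_descent:
  assumes s: "s \<in> left_descents w" and t: "t \<in> right_descents w" and w: "w \<in> carrier W"
    and neq: "s \<otimes> w \<noteq> w \<otimes> t"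
  shows "t \<in> right_descents (s \<otimes> w)"
proof (rule ccontr)
  assume right: "t \<notin> right_descents (s \<otimes> w)"
  have st: "s \<in> S" "t \<in> S" using s t left_descents_subset right_descents_subset by auto
  have left: "s \<notin> left_descents (s \<otimes> w)" using left_descents_generator_mult[OF st(1) w] s by blast
  have "s \<otimes> (s \<otimes> w) \<noteq> s \<otimes> w \<otimes> t"
    using neq mult_generator_eq_iff[of t "s \<otimes> w" w] st w by force
  then have "\<ell> (s \<otimes> (s \<otimes> w) \<otimes> t) = \<ell> (s \<otimes> w) + 2"
    using cox_length_two_sided_ascent[OF st _ left right] st(1) w by blast
  then have "\<ell> (w \<otimes> t) = \<ell> w + 1" using s st w left_descent_iff[OF st(1) w] by simp
  then show False using t unfolding right_descents_def by simp
qed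

lemma parabolic_subgroup: "J \<subseteq> S \<Longrightarrow> subgroup (parabolic J) W"
  using S_subset by (intro generate_is_subgroup) auto

lemma reduced_parabolic_word_exists:
  assumes J: "J \<subseteq> S" and "x \<in> parabolic J"
  obtains ws where "ws \<in> lists J" "wprod ws = x" "length ws = \<ell> x"
proof -
  have "\<exists>rs \<in> lists J. wprod rs = wprod ws \<and> length rs = \<ell> (wprod ws)" if "ws \<in> lists J" for ws
    using that
  proof (induction ws)
    case (Cons s ws)
    then obtain rs where rs: "rs \<in> lists J" "wprod rs = wprod ws" "length rs = \<ell> (wprod ws)"
      by blast
    then have rsS: "rs \<in> lists S" and s: "s \<in> J" "s \<in> S" using J Cons.hyps lists_mono[OF J] by auto
    from s(2) word_prod_closed[OF rsS] show ?case
    proof (cases rule: cox_length_generator_mult)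
      case ascent
      then show ?thesis using rs s by (intro bexI[of _ "s # rs"]) auto
    next
      case descent
      then obtain a t b where "rs = a @ t # b" "s \<otimes> wprod rs = wprod (a @ b)"
        using exchange[OF s(2) rsS] by auto
      then show ?thesis using rs descent by (intro bexI[of _ "a @ b"]) auto
    qed
  qed auto
  then show thesis using that assms(2) unfolding parabolic_eq_word_prods[OF J] by blast
qed

lemma parabolic_induct [consumes 2, case_names one mult]:
  assumes J: "J \<subseteq> S" and x: "x \<in> parabolic J" and "P \<one>"
    and mult: "\<And>s y. s \<in> J \<Longrightarrow> y \<in> parabolic J \<Longrightarrow> s \<notin> left_descents y \<Longrightarrow> P y \<Longrightarrow> P (s \<otimes> y)"
  shows "P x"
proof -
  obtain ws where "ws \<in> lists J" "wprod ws = x" "length ws = \<ell> x"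
    using reduced_parabolic_word_exists[OF J x] .
  then show ?thesis
  proof (induction ws arbitrary: x)
    case Nil
    then show ?case using \<open>P \<one>\<close> by simp
  next
    case (Cons s ws)
    then have s: "s \<in> J" "s \<in> S" and ws: "ws \<in> lists S" "wprod ws \<in> parabolic J"
      using J lists_mono[OF J] parabolic_eq_word_prods[OF J] by auto
    from s(2) word_prod_closed[OF ws(1)] have "length ws = \<ell> (wprod ws)"
      using Cons.prems cox_length_word_prod_le[OF ws(1)]
      by (cases rule: cox_length_generator_mult) auto
    moreover from this have "s \<notin> left_descents (wprod ws)"
      using Cons.prems unfolding left_descents_def by auto
    ultimately show ?case using Cons.IH Cons.prems mult s(1) ws(2) by auto
  qed
qed

lemma parabolic_Int_generators: assumes J: "J \<subseteq> S" shows "parabolic J \<inter> S = J"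
proof
  show "parabolic J \<inter> S \<subseteq> J"
  proof
    fix s assume s: "s \<in> parabolic J \<inter> S"
    obtain ws where ws: "ws \<in> lists J" "wprod ws = s" "length ws = \<ell> s"
      using reduced_parabolic_word_exists[OF J IntD1[OF s]] .
    then have "length ws = 1" using s by (simp add: cox_length_generator)
    then obtain t where t: "ws = [t]" unfolding One_nat_def length_Suc_conv by blast
    then have "t \<in> J" "t = s" using ws(1,2) subsetD[OF J] by auto
    then show "s \<in> J" by simp
  qed
  show "J \<subseteq> parabolic J \<inter> S" using J by (auto intro: generate.incl)
qed

lemma parabolic_singleton: "s \<in> S \<Longrightarrow> parabolic {s} \<subseteq> {\<one>, s}"
proof
  fix x assume "s \<in> S" "x \<in> parabolic {s}"
  from this(2) show "x \<in> {\<one>, s}" by induction (use \<open>s \<in> S\<close> in auto)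
qed

lemma minimal_coset_representative_exists:
  assumes J: "J \<subseteq> S" and w: "w \<in> carrier W"
  obtains x u where "x \<in> parabolic J" "u \<in> carrier W" "w = x \<otimes> u"
    "\<forall>y \<in> parabolic J. \<ell> u \<le> \<ell> (y \<otimes> u)"
proof -
  interpret P: subgroup "parabolic J" W by (rule parabolic_subgroup[OF J])
  obtain x where x: "x \<in> parabolic J"
    and min: "\<And>y. y \<in> parabolic J \<Longrightarrow> \<ell> (inv x \<otimes> w) \<le> \<ell> (inv y \<otimes> w)"
    using ex_has_least_nat[of "\<lambda>x. x \<in> parabolic J" \<one> "\<lambda>x. \<ell> (inv x \<otimes> w)"] P.one_closed
    by blast
  then have xc: "x \<in> carrier W" by simp
  show thesis
  proof (rule that)
    show "\<forall>y \<in> parabolic J. \<ell> (inv x \<otimes> w) \<le> \<ell> (y \<otimes> (inv x \<otimes> w))"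
    proof
      fix y assume "y \<in> parabolic J"
      then show "\<ell> (inv x \<otimes> w) \<le> \<ell> (y \<otimes> (inv x \<otimes> w))"
        using min[of "x \<otimes> inv y"] x w by (simp add: inv_mult_group m_assoc)
    qed
    show "w = x \<otimes> (inv x \<otimes> w)" using mult_inv_cancel_left[OF xc w] by simp
  qed (use x xc w in simp_all)
qed

lemma cox_length_mult_minimal:
  assumes J: "J \<subseteq> S" and x: "x \<in> parabolic J" and u: "u \<in> carrier W"
    and min: "\<forall>y \<in> parabolic J. \<ell> u \<le> \<ell> (y \<otimes> u)"
  shows "\<ell> (x \<otimes> u) = \<ell> x + \<ell> u"
  using J x
proof (induction rule: parabolic_induct)
  case (mult s y)
  interpret P: subgroup "parabolic J" W by (rule parabolic_subgroup[OF J])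
  have s: "s \<in> S" and y: "y \<in> carrier W" using mult J by auto
  have "s \<notin> left_descents (y \<otimes> u)"
  proof
    assume "s \<in> left_descents (y \<otimes> u)"
    then have descent: "\<ell> (s \<otimes> (y \<otimes> u)) < \<ell> (y \<otimes> u)" unfolding left_descents_def by blast
    from s y u descent show False
    proof (cases rule: exchange_mult)
      case left
      then show False using mult s unfolding left_descents_def by blast
    next
      case (right z)
      then have "inv y \<otimes> (s \<otimes> (y \<otimes> u)) = z" using y by simp
      then have z: "inv y \<otimes> s \<otimes> y \<otimes> u = z" using s y u by (simp add: m_assoc)
      have "inv y \<otimes> s \<otimes> y \<in> parabolic J" using mult(1,2) by (simp add: generate.incl)
      then have "\<ell> u \<le> \<ell> z" using min unfolding z[symmetric] by blast
      then show False using right by simp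
    qed
  qed
  then show ?case using mult s y u by (simp add: left_ascent_iff m_assoc)
qed (use u in simp)

lemma mem_parabolic_if_conj_right_descents:
  assumes J: "J \<subseteq> S" and w: "w \<in> carrier W"
    and conj: "\<And>t. t \<in> right_descents w \<Longrightarrow> w \<otimes> t \<otimes> inv w \<in> parabolic J"
  shows "w \<in> parabolic J"
proof -
  interpret P: subgroup "parabolic J" W by (rule parabolic_subgroup[OF J])
  obtain x u where x: "x \<in> parabolic J" and u: "u \<in> carrier W" and xu: "w = x \<otimes> u"
    and min: "\<forall>y \<in> parabolic J. \<ell> u \<le> \<ell> (y \<otimes> u)"
    by (rule minimal_coset_representative_exists[OF J w])
  have "right_descents u = {}"
  proof (rule ccontr)
    assume "right_descents u \<noteq> {}"
    then obtain t where t: "t \<in> S" "\<ell> (u \<otimes> t) < \<ell> u" unfolding right_descents_def by blast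
    have "\<ell> (w \<otimes> t) < \<ell> w"
      using cox_length_mult_le[of x "u \<otimes> t"] cox_length_mult_minimal[OF J x u min] xu x u t
      by (simp add: m_assoc)
    then have "w \<otimes> t \<otimes> inv w \<in> parabolic J" using conj t unfolding right_descents_def by blast
    then have "inv x \<otimes> (w \<otimes> t \<otimes> inv w) \<otimes> x \<in> parabolic J" using x by simp
    then have "\<ell> u \<le> \<ell> (inv x \<otimes> (w \<otimes> t \<otimes> inv w) \<otimes> x \<otimes> u)" using min by blast
    moreover have "inv x \<otimes> (w \<otimes> t \<otimes> inv w) \<otimes> x \<otimes> u = u \<otimes> t"
      using x u t w by (simp add: xu inv_mult_group m_assoc)
    ultimately show False using t by simp
  qed
  then have "inv u = \<one>" using left_descents_nonempty[of "inv u"] left_descents_inv[OF u] u by blast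
  then have "u = \<one>" using u by simp
  then show ?thesis using x xu by simp
qed

lemma cox_length_add_if_descents:
  assumes J: "J \<subseteq> left_descents w" and w: "w \<in> carrier W" and x: "x \<in> parabolic J"
  shows "\<ell> x + \<ell> (inv x \<otimes> w) = \<ell> w"
proof -
  have JS: "J \<subseteq> S" using J left_descents_subset by blast
  interpret P: subgroup "parabolic J" W by (rule parabolic_subgroup[OF JS])
  from JS x have "\<ell> x + \<ell> (inv x \<otimes> w) \<le> \<ell> w"
  proof (induction rule: parabolic_induct)
    case one
    then show ?case using w by simp
  next
    case (mult s y)
    have s: "s \<in> S" and y: "y \<in> carrier W" using mult JS by auto
    have yw: "inv y \<otimes> w \<in> carrier W" "y \<otimes> (inv y \<otimes> w) = w" using y w by auto
    then have descent: "\<ell> (s \<otimes> (y \<otimes> (inv y \<otimes> w))) < \<ell> (y \<otimes> (inv y \<otimes> w))"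
      using J mult(1) unfolding left_descents_def by auto
    from s y yw(1) descent have "\<ell> (inv y \<otimes> (s \<otimes> w)) < \<ell> (inv y \<otimes> w)"
    proof (cases rule: exchange_mult)
      case left
      then show ?thesis using mult s unfolding left_descents_def by blast
    next
      case (right z)
      then have "inv y \<otimes> (s \<otimes> w) = z" unfolding yw(2) using y by simp
      then show ?thesis using right by simp
    qed
    then show ?case
      using mult s y w by (simp add: left_ascent_iff inv_mult_group m_assoc)
  qed
  moreover have "\<ell> w \<le> \<ell> x + \<ell> (inv x \<otimes> w)"
    using cox_length_mult_le[of x "inv x \<otimes> w"] x w by simp
  ultimately show ?thesis by simp
qed

lemma finite_parabolic_left_descents:
  assumes "finite S" "w \<in> carrier W"
  shows "finite (parabolic (left_descents w))"
proof (rule finite_subset)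
  show "parabolic (left_descents w) \<subseteq> wprod ` {ws. set ws \<subseteq> S \<and> length ws \<le> \<ell> w}"
  proof
    fix x assume x: "x \<in> parabolic (left_descents w)"
    interpret P: subgroup "parabolic (left_descents w)" W
      by (rule parabolic_subgroup[OF left_descents_subset])
    obtain ws where "ws \<in> lists S" "wprod ws = x" "length ws = \<ell> x"
      using reduced_word_exists[OF P.mem_carrier[OF x]] .
    then show "x \<in> wprod ` {ws. set ws \<subseteq> S \<and> length ws \<le> \<ell> w}"
      using cox_length_add_if_descents[OF subset_refl assms(2) x] by force
  qed
  show "finite (wprod ` {ws. set ws \<subseteq> S \<and> length ws \<le> \<ell> w})"
    using assms(1) by (intro finite_imageI finite_lists_length_le)
qed

lemma mem_parabolic_right_descents_if_conj:
  assumes w: "w \<in> carrier W" and conj: "(\<lambda>s. w \<otimes> s \<otimes> inv w) ` right_descents w = left_descents w"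
  shows "w \<in> parabolic (right_descents w)"
proof -
  interpret P: subgroup "parabolic (right_descents w)" W
    by (rule parabolic_subgroup[OF right_descents_subset])
  have "inv w \<otimes> t \<otimes> inv (inv w) \<in> parabolic (right_descents w)"
    if "t \<in> right_descents (inv w)" for t
  proof -
    have "t \<in> (\<lambda>s. w \<otimes> s \<otimes> inv w) ` right_descents w"
      using that unfolding conj right_descents_inv[OF w] .
    then obtain s where s: "s \<in> right_descents w" "t = w \<otimes> s \<otimes> inv w" by blast
    then have "inv w \<otimes> t \<otimes> inv (inv w) = s"
      using w subsetD[OF right_descents_subset] by (simp add: m_assoc)
    then show ?thesis using s(1) by (simp add: generate.incl)
  qed
  then have "inv w \<in> parabolic (right_descents w)"
    by (rule mem_parabolic_if_conj_right_descents[OF right_descents_subset inv_closed[OF w]])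
  then show ?thesis using P.m_inv_closed[of "inv w"] w by simp
qed

lemma left_descents_eq_right_descents_if_conj:
  assumes w: "w \<in> carrier W" and conj: "(\<lambda>s. w \<otimes> s \<otimes> inv w) ` right_descents w = left_descents w"
  shows "left_descents w = right_descents w"
proof -
  have subset: "left_descents w \<subseteq> right_descents w"
    if w: "w \<in> carrier W" and conj: "(\<lambda>s. w \<otimes> s \<otimes> inv w) ` right_descents w = left_descents w" for w
  proof -
    interpret P: subgroup "parabolic (right_descents w)" W
      by (rule parabolic_subgroup[OF right_descents_subset])
    have "w \<otimes> s \<otimes> inv w \<in> parabolic (right_descents w)" if "s \<in> right_descents w" for s
      using mem_parabolic_right_descents_if_conj[OF w conj] that by (simp add: generate.incl)
    then have "left_descents w \<subseteq> parabolic (right_descents w)" unfolding conj[symmetric] by blast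
    then have "left_descents w \<subseteq> parabolic (right_descents w) \<inter> S"
      using left_descents_subset by blast
    then show ?thesis by (simp only: parabolic_Int_generators[OF right_descents_subset])
  qed
  have "inv w \<otimes> (w \<otimes> s \<otimes> inv w) \<otimes> w = s" if "s \<in> right_descents w" for s
    using that w subsetD[OF right_descents_subset] by (simp add: m_assoc)
  then have "(\<lambda>t. inv w \<otimes> t \<otimes> inv (inv w)) ` left_descents w = right_descents w"
    using w unfolding conj[symmetric] image_image by simp
  then have "right_descents w \<subseteq> left_descents w"
    using subset[of "inv w"] w by (simp add: left_descents_inv right_descents_inv)
  then show ?thesis using subset[OF w conj] by blast
qed

end

section \<open>Buildings\<close>

context building
begin

lemma dist_self [simp]: "C \<in> Ch \<Longrightarrow> \<delta> C C = \<one>"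
  using WD1 by blast

lemma dist_step:
  "C \<in> Ch \<Longrightarrow> D \<in> Ch \<Longrightarrow> E \<in> Ch \<Longrightarrow> s \<in> S \<Longrightarrow> \<delta> C D = s \<Longrightarrow> \<delta> C E \<in> {s \<otimes> \<delta> D E, \<delta> D E}"
  using WD2 by blast

lemma dist_generator_sym:
  assumes "C \<in> Ch" "D \<in> Ch" "s \<in> S" "\<delta> C D = s" shows "\<delta> D C = s"
proof -
  have "\<one> \<in> {s \<otimes> \<delta> D C, \<delta> D C}" using dist_step[OF assms(1,2,1,3,4)] assms(1) by simp
  moreover have "\<delta> D C \<noteq> \<one>"
    using WD1[OF assms(2,1)] generator_neq_one[OF assms(3)] assms by auto
  ultimately have "s \<otimes> \<delta> D C = \<one>" by auto
  then show ?thesis using assms(1-3) dist_closed by (simp add: generator_mult_eq_iff)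
qed

lemma dist_step_exists:
  assumes "C \<in> Ch" "D \<in> Ch" "s \<in> S"
  obtains B where "B \<in> Ch" "\<delta> C B = s" "\<delta> B D = s \<otimes> \<delta> C D"
  using WD3[OF assms] dist_generator_sym assms by blast

lemma panel_trans:
  assumes "C \<in> Ch" "D \<in> Ch" "E \<in> Ch" "s \<in> S" "\<delta> C D = s" "\<delta> C E = s" "D \<noteq> E"
  shows "\<delta> D E = s"
  using dist_step[OF assms(2,1,3,4)] dist_generator_sym[OF assms(1,2,4,5)] WD1[OF assms(2,3)] assms
  by auto

lemma gallery_induct [consumes 4, case_names base step]:
  assumes J: "J \<subseteq> S" and "C \<in> Ch" and D: "D \<in> Ch" and "\<delta> C D \<in> parabolic J" and "P D"
    and step: "\<And>A B s. A \<in> Ch \<Longrightarrow> B \<in> Ch \<Longrightarrow> s \<in> J \<Longrightarrow> \<delta> A B = s \<Longrightarrow> P B \<Longrightarrow> P A"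
  shows "P C"
proof -
  from J \<open>\<delta> C D \<in> parabolic J\<close> have "\<forall>A \<in> Ch. \<delta> A D = \<delta> C D \<longrightarrow> P A"
  proof (induction rule: parabolic_induct)
    case one
    then show ?case using D WD1 \<open>P D\<close> by blast
  next
    case (mult s y)
    then have s: "s \<in> S" and y: "y \<in> carrier W"
      using J subgroup.mem_carrier[OF parabolic_subgroup[OF J]] by auto
    show ?case
    proof (intro ballI impI)
      fix A assume A: "A \<in> Ch" "\<delta> A D = s \<otimes> y"
      obtain B where B: "B \<in> Ch" "\<delta> A B = s" "\<delta> B D = s \<otimes> \<delta> A D"
        using dist_step_exists[OF A(1) D s] .
      then have "P B" using mult A s y by simp
      then show "P A" using step A(1) B(1,2) mult(1) by blast
    qed
  qed
  then show ?thesis using \<open>C \<in> Ch\<close> by blast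
qed

lemma dist_parabolic_step:
  assumes "J \<subseteq> S" "A \<in> Ch" "B \<in> Ch" "D \<in> Ch" "s \<in> J" "\<delta> A B = s" "\<delta> B D \<in> parabolic J"
  shows "\<delta> A D \<in> parabolic J"
proof -
  have "\<delta> A D \<in> {s \<otimes> \<delta> B D, \<delta> B D}" using dist_step[of A B D s] assms by blast
  then show ?thesis using generate.eng[OF generate.incl[OF assms(5)] assms(7)] assms(7) by auto
qed

end

section \<open>Twin buildings\<close>

lemma opp_sign_opp_sign [simp]: "opp_sign (opp_sign \<epsilon>) = \<epsilon>"
  by (cases \<epsilon>) auto

context twin_building
begin

sublocale half: building W S "\<Delta> \<epsilon>" \<delta> for \<epsilon>
  by (rule halves)

lemma codist_descent:
  assumes "C \<in> \<Delta> \<epsilon>" "D \<in> \<Delta> (opp_sign \<epsilon>)" "E \<in> \<Delta> (opp_sign \<epsilon>)" "\<delta> D E = s"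
    and "s \<in> left_descents (\<delta>s C D)"
  shows "\<delta>s C E = s \<otimes> \<delta>s C D"
proof -
  have s: "s \<in> S" using assms(5) left_descents_subset by blast
  then show ?thesis
    using Tw2[OF assms(1-3) s assms(4)] assms(5) left_descent_iff[OF s codist_closed[OF assms(1,2)]]
    by simp
qed

lemma codist_step:
  assumes "C \<in> \<Delta> \<epsilon>" "D \<in> \<Delta> (opp_sign \<epsilon>)" "E \<in> \<Delta> (opp_sign \<epsilon>)" "s \<in> S" "\<delta> D E = s"
  shows "\<delta>s C E \<in> {\<delta>s C D, s \<otimes> \<delta>s C D}"
proof (cases "s \<in> left_descents (\<delta>s C D)")
  case True
  then show ?thesis using codist_descent assms by blast
next
  case False
  have w: "\<delta>s C D \<in> carrier W" using codist_closed assms by blast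
  obtain B where B: "B \<in> \<Delta> (opp_sign \<epsilon>)" "\<delta> D B = s" "\<delta>s C B = s \<otimes> \<delta>s C D"
    using Tw3[OF assms(1,2,4)] by blast
  show ?thesis
  proof (cases "B = E")
    case False
    then have "\<delta> B E = s" using half.panel_trans[OF assms(2) B(1) assms(3,4) B(2) assms(5)] by simp
    moreover have "s \<in> left_descents (\<delta>s C B)"
      using \<open>s \<notin> left_descents (\<delta>s C D)\<close> B(3) left_descents_generator_mult[OF assms(4) w] by simp
    ultimately have "\<delta>s C E = s \<otimes> \<delta>s C B" using codist_descent[OF assms(1) B(1) assms(3)] by blast
    then show ?thesis using B(3) assms(4) w by simp
  qed (use B in simp)
qed

lemma codist_step_left:
  assumes "C \<in> \<Delta> \<epsilon>" "B \<in> \<Delta> \<epsilon>" "D \<in> \<Delta> (opp_sign \<epsilon>)" "s \<in> S" "\<delta> C B = s"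
  shows "\<delta>s B D \<in> {\<delta>s C D, \<delta>s C D \<otimes> s}"
proof -
  have "\<delta>s D B \<in> {inv (\<delta>s C D), s \<otimes> inv (\<delta>s C D)}"
    using codist_step[of D "opp_sign \<epsilon>" C B s] Tw1[OF assms(1,3)] assms by simp
  moreover have "\<delta>s B D = inv (\<delta>s D B)" using Tw1[of D "opp_sign \<epsilon>" B] assms by simp
  moreover have "\<delta>s C D \<in> carrier W" using codist_closed[OF assms(1,3)] .
  ultimately show ?thesis using assms(4) by (auto simp: inv_mult_group)
qed

lemma codist_descent_left:
  assumes "C \<in> \<Delta> \<epsilon>" "B \<in> \<Delta> \<epsilon>" "D \<in> \<Delta> (opp_sign \<epsilon>)" "\<delta> C B = s"
    and "s \<in> right_descents (\<delta>s C D)"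
  shows "\<delta>s B D = \<delta>s C D \<otimes> s"
proof -
  have w: "\<delta>s C D \<in> carrier W" and s: "s \<in> S"
    using codist_closed assms right_descents_subset by blast+
  have "\<delta>s D C = inv (\<delta>s C D)" using Tw1 assms by blast
  then have "\<delta>s D B = s \<otimes> inv (\<delta>s C D)"
    using codist_descent[of D "opp_sign \<epsilon>" C B s] assms w by (simp add: left_descents_inv)
  then show ?thesis using Tw1[of D "opp_sign \<epsilon>" B] assms w s by (simp add: inv_mult_group)
qed

lemma Tw3_left:
  assumes "C \<in> \<Delta> \<epsilon>" "D \<in> \<Delta> (opp_sign \<epsilon>)" "s \<in> S"
  obtains B where "B \<in> \<Delta> \<epsilon>" "\<delta> C B = s" "\<delta>s B D = \<delta>s C D \<otimes> s"
proof -
  obtain B where B: "B \<in> \<Delta> \<epsilon>" "\<delta> C B = s" "\<delta>s D B = s \<otimes> \<delta>s D C"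
    using Tw3[of D "opp_sign \<epsilon>" C s] assms by auto
  moreover have "\<delta>s B D = \<delta>s C D \<otimes> s"
    using Tw1[of D "opp_sign \<epsilon>" B] Tw1[OF assms(1,2)] codist_closed[OF assms(1,2)] B assms
    by (simp add: inv_mult_group)
  ultimately show thesis using that by blast
qed

definition residue :: "sign \<Rightarrow> 'w set \<Rightarrow> 'c \<Rightarrow> 'c set" where
  "residue \<epsilon> J C = {D \<in> \<Delta> \<epsilon>. \<delta> C D \<in> parabolic J}"

lemma residue_of_type_residue: "C \<in> \<Delta> \<epsilon> \<Longrightarrow> residue_of_type W \<Delta> \<delta> \<epsilon> J (residue \<epsilon> J C)"
  unfolding residue_of_type_def residue_def by blast

lemma codist_residue_attained:
  assumes J: "J \<subseteq> S" and C: "C \<in> \<Delta> \<epsilon>" and D: "D \<in> \<Delta> (opp_sign \<epsilon>)" and g: "g \<in> parabolic J"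
  shows "\<exists>E \<in> residue (opp_sign \<epsilon>) J D. \<delta>s C E = g \<otimes> \<delta>s C D"
proof -
  interpret P: subgroup "parabolic J" W by (rule parabolic_subgroup[OF J])
  have "inv g \<in> parabolic J" using g by simp
  \<comment> \<open>Moving \<open>D\<close> multiplies the codistance on the left, so the factors of \<open>g\<close> are used up from the right.\<close>
  with J have "\<forall>D \<in> \<Delta> (opp_sign \<epsilon>). \<exists>E \<in> residue (opp_sign \<epsilon>) J D. \<delta>s C E = inv (inv g) \<otimes> \<delta>s C D"
  proof (induction rule: parabolic_induct)
    case one
    then show ?case using codist_closed[OF C] generate.one[of W J] unfolding residue_def by force
  next
    case (mult s y)
    then have s: "s \<in> S" and y: "y \<in> carrier W" using J by auto
    show ?case
    proof
      fix D assume D: "D \<in> \<Delta> (opp_sign \<epsilon>)"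
      obtain B where B: "B \<in> \<Delta> (opp_sign \<epsilon>)" "\<delta> D B = s" "\<delta>s C B = s \<otimes> \<delta>s C D"
        using Tw3[OF C D s] by blast
      obtain E where E: "E \<in> residue (opp_sign \<epsilon>) J B" "\<delta>s C E = inv y \<otimes> \<delta>s C B"
        using mult B(1) by blast
      have "E \<in> residue (opp_sign \<epsilon>) J D"
        using half.dist_parabolic_step[OF J D B(1) _ mult(1) B(2)] E(1)
        unfolding residue_def by blast
      moreover have "\<delta>s C E = inv (s \<otimes> y) \<otimes> \<delta>s C D"
        using E(2) B(3) s y codist_closed[OF C D] by (simp add: inv_mult_group m_assoc)
      ultimately show "\<exists>E \<in> residue (opp_sign \<epsilon>) J D. \<delta>s C E = inv (s \<otimes> y) \<otimes> \<delta>s C D" by blast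
    qed
  qed
  then show ?thesis using D g by simp
qed

lemma codist_residue_coset:
  assumes J: "J \<subseteq> S" and C: "C \<in> \<Delta> \<epsilon>" and D: "D \<in> \<Delta> (opp_sign \<epsilon>)"
    and E: "E \<in> residue (opp_sign \<epsilon>) J D"
  shows "\<exists>g \<in> parabolic J. \<delta>s C E = g \<otimes> \<delta>s C D"
proof -
  have E': "E \<in> \<Delta> (opp_sign \<epsilon>)" "\<delta> D E \<in> parabolic J" using E unfolding residue_def by auto
  from J D E' show ?thesis
  proof (induction rule: half.gallery_induct)
    case base
    then show ?case using codist_closed[OF C E'(1)] generate.one[of W J] by force
  next
    case (step A B s)
    then obtain g where g: "g \<in> parabolic J" "\<delta>s C E = g \<otimes> \<delta>s C B" by blast
    then have gs: "g \<otimes> s \<in> parabolic J" using step(3) generate.incl generate.eng by metis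
    have "s \<in> S" "g \<in> carrier W"
      using step(3) g(1) J subgroup.mem_carrier[OF parabolic_subgroup[OF J]] by auto
    moreover from this have "\<delta>s C B \<in> {\<delta>s C A, s \<otimes> \<delta>s C A}"
      using codist_step[OF C step(1,2)] step(4) by blast
    ultimately have "\<delta>s C E = g \<otimes> \<delta>s C A \<or> \<delta>s C E = g \<otimes> s \<otimes> \<delta>s C A"
      using g(2) codist_closed[OF C step(1)] by (auto simp: m_assoc)
    then show ?case using g(1) gs by blast
  qed
qed

lemma opposite_residues_if_codist_in_parabolic:
  assumes J: "J \<subseteq> S" and C: "C \<in> \<Delta> \<epsilon>" and D: "D \<in> \<Delta> (opp_sign \<epsilon>)" and w: "\<delta>s C D \<in> parabolic J"
  shows "opposite_residues W S \<Delta> \<delta> \<delta>s (residue (opp_sign \<epsilon>) J D) (residue \<epsilon> J C)"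
proof -
  interpret P: subgroup "parabolic J" W by (rule parabolic_subgroup[OF J])
  have "\<exists>E' \<in> residue \<epsilon> J C. opposite W \<Delta> \<delta>s E E'" if R: "E \<in> residue (opp_sign \<epsilon>) J D" for E
  proof -
    have E: "E \<in> \<Delta> (opp_sign \<epsilon>)" using R unfolding residue_def by blast
    obtain g where "g \<in> parabolic J" "\<delta>s C E = g \<otimes> \<delta>s C D"
      using codist_residue_coset[OF J C D R] by blast
    then have "\<delta>s C E \<in> parabolic J" using w by simp
    then obtain E' where E': "E' \<in> residue \<epsilon> J C" "\<delta>s E E' = \<delta>s C E \<otimes> \<delta>s E C"
      using codist_residue_attained[OF J E, of C "\<delta>s C E"] C by auto
    then have "\<delta>s E E' = \<one>" using Tw1[OF C E] codist_closed[OF C E] by simp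
    then show ?thesis using E E'(1) unfolding opposite_def residue_def by force
  qed
  moreover have "residue_in W S \<Delta> \<delta> (opp_sign \<epsilon>) (residue (opp_sign \<epsilon>) J D)"
    "residue_in W S \<Delta> \<delta> (opp_sign (opp_sign \<epsilon>)) (residue \<epsilon> J C)"
    unfolding residue_in_def using J residue_of_type_residue C D by auto
  ultimately show ?thesis unfolding opposite_residues_def by blast
qed

lemma residue_image_subset:
  assumes K: "K \<subseteq> S" and J: "J \<subseteq> S" and C: "C \<in> \<Delta> \<epsilon>"
    and f: "\<And>A. A \<in> \<Delta> \<epsilon> \<Longrightarrow> f A \<in> \<Delta> \<eta>"
    and step: "\<And>A B. A \<in> \<Delta> \<epsilon> \<Longrightarrow> B \<in> \<Delta> \<epsilon> \<Longrightarrow> \<delta> A B \<in> K \<Longrightarrow> \<delta> (f A) (f B) \<in> J"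
  shows "f ` residue \<epsilon> K C \<subseteq> residue \<eta> J (f C)"
proof
  fix D' assume "D' \<in> f ` residue \<epsilon> K C"
  then obtain D where D: "D \<in> \<Delta> \<epsilon>" "\<delta> C D \<in> parabolic K" "D' = f D" unfolding residue_def by blast
  from K C D(1,2) have "\<delta> (f C) (f D) \<in> parabolic J"
  proof (induction rule: half.gallery_induct)
    case base
    then show ?case using f[OF D(1)] generate.one[of W J] by simp
  next
    case (step A B s)
    then show ?case
      using half.dist_parabolic_step[OF J f f f] assms(5) D(1) by blast
  qed
  then show "D' \<in> residue \<eta> J (f C)" using f[OF D(1)] D(3) unfolding residue_def by blast
qed

lemma codist_attained:
  assumes "C \<in> \<Delta> \<epsilon>" "g \<in> carrier W"
  shows "\<exists>D \<in> \<Delta> (opp_sign \<epsilon>). \<delta>s C D = g"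
proof -
  obtain D where D: "D \<in> \<Delta> (opp_sign \<epsilon>)" using half.nonempty by blast
  then have c: "\<delta>s C D \<in> carrier W" using codist_closed assms by blast
  then have "g \<otimes> inv (\<delta>s C D) \<in> parabolic S" using assms S_generates by simp
  then obtain E where "E \<in> residue (opp_sign \<epsilon>) S D" "\<delta>s C E = g \<otimes> inv (\<delta>s C D) \<otimes> \<delta>s C D"
    using codist_residue_attained[OF subset_refl assms(1) D] by blast
  then show ?thesis using c assms unfolding residue_def by (auto simp: m_assoc)
qed

lemma opposite_if_codist_eq_dist:
  assumes Z: "Z \<in> \<Delta> \<epsilon>" and C: "C \<in> \<Delta> (opp_sign \<epsilon>)"
    and E: "E \<in> \<Delta> (opp_sign \<epsilon>)" and eq: "\<delta>s Z C = \<delta> C E"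
  shows "\<delta>s Z E = \<one>"
proof -
  have "\<delta> C E \<in> parabolic S" using half.dist_closed C E S_generates by blast
  with subset_refl have "\<forall>A \<in> \<Delta> (opp_sign \<epsilon>). \<delta> A E = \<delta> C E \<and> \<delta>s Z A = \<delta> C E \<longrightarrow> \<delta>s Z E = \<one>"
  proof (induction rule: parabolic_induct)
    case one
    then show ?case using half.WD1 E by blast
  next
    case (mult s y)
    then have y: "y \<in> carrier W" using S_generates by simp
    show ?case
    proof (intro ballI impI)
      fix A assume A: "A \<in> \<Delta> (opp_sign \<epsilon>)" "\<delta> A E = s \<otimes> y \<and> \<delta>s Z A = s \<otimes> y"
      obtain B where B: "B \<in> \<Delta> (opp_sign \<epsilon>)" "\<delta> A B = s" "\<delta> B E = s \<otimes> \<delta> A E"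
        using half.dist_step_exists[OF A(1) E mult(1)] .
      have "s \<in> left_descents (\<delta>s Z A)"
        using A(2) mult y by (simp add: left_descents_generator_mult)
      then have "\<delta>s Z B = s \<otimes> \<delta>s Z A" using codist_descent[OF Z A(1) B(1,2)] by blast
      then have "\<delta> B E = y" "\<delta>s Z B = y" using mult(1) y A(2) B(3) by auto
      then show "\<delta>s Z E = \<one>" using mult(4) B(1) by blast
    qed
  qed
  then show ?thesis using C eq by blast
qed

lemma opposite_with_codist_exists:
  assumes C: "C \<in> \<Delta> \<epsilon>" and E: "E \<in> \<Delta> \<epsilon>"
  obtains Z where "Z \<in> \<Delta> (opp_sign \<epsilon>)" "\<delta>s E Z = \<one>" "\<delta>s C Z = inv (\<delta> C E)"
proof -
  have d: "\<delta> C E \<in> carrier W" using half.dist_closed C E by blast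
  then obtain Z where Z: "Z \<in> \<Delta> (opp_sign \<epsilon>)" "\<delta>s C Z = inv (\<delta> C E)"
    using codist_attained[OF C] inv_closed by blast
  then have "\<delta>s Z C = \<delta> C E" using Tw1[OF C Z(1)] d by simp
  then have "\<delta>s Z E = \<one>" using opposite_if_codist_eq_dist[OF Z(1), of C E] C E by simp
  then show thesis using that[OF Z(1) _ Z(2)] Tw1[OF Z(1), of E] E by simp
qed

text \<open>
  An automorphism is not assumed to preserve panels or their types, so these have to be recognised from
  opposition alone.
\<close>

lemma dist_eq_iff_opposite:
  assumes C: "C \<in> \<Delta> \<epsilon>" and D: "D \<in> \<Delta> \<epsilon>" and E: "E \<in> \<Delta> \<epsilon>" and s: "s \<in> S"
    and CD: "\<delta> C D = s" and "C \<noteq> E"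
  shows "\<delta> C E = s \<longleftrightarrow> (\<forall>Z \<in> \<Delta> (opp_sign \<epsilon>). \<delta>s E Z = \<one> \<longrightarrow> \<delta>s C Z = \<one> \<or> \<delta>s D Z = \<one>)"
proof
  assume CE: "\<delta> C E = s"
  have "\<delta>s C Z = \<one> \<or> \<delta>s D Z = \<one>" if Z: "Z \<in> \<Delta> (opp_sign \<epsilon>)" "\<delta>s E Z = \<one>" for Z
  proof -
    have "\<delta>s C Z \<in> {\<one>, s}"
      using codist_step_left[OF E C Z(1) s] half.dist_generator_sym[OF C E s CE] Z(2) s by simp
    moreover have "\<delta>s D Z = \<one>" if "\<delta>s C Z = s"
      using codist_descent_left[OF C D Z(1) CD] that s by (simp add: right_descents_generator)
    ultimately show ?thesis by blast
  qed
  then show "\<forall>Z \<in> \<Delta> (opp_sign \<epsilon>). \<delta>s E Z = \<one> \<longrightarrow> \<delta>s C Z = \<one> \<or> \<delta>s D Z = \<one>" by blast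
next
  assume opp: "\<forall>Z \<in> \<Delta> (opp_sign \<epsilon>). \<delta>s E Z = \<one> \<longrightarrow> \<delta>s C Z = \<one> \<or> \<delta>s D Z = \<one>"
  have d: "\<delta> C E \<in> carrier W" "\<delta> C E \<noteq> \<one>" using half.dist_closed half.WD1 C E \<open>C \<noteq> E\<close> by auto
  obtain Z where Z: "Z \<in> \<Delta> (opp_sign \<epsilon>)" "\<delta>s E Z = \<one>" "\<delta>s C Z = inv (\<delta> C E)"
    using opposite_with_codist_exists[OF C E] .
  then have "\<delta>s C Z \<noteq> \<one>" using d by simp
  then have "\<delta>s D Z = \<one>" using opp Z(1,2) by blast
  then have "inv (\<delta> C E) \<otimes> s = \<one>"
    using codist_step_left[OF C D Z(1) s CD] \<open>\<delta>s C Z \<noteq> \<one>\<close> Z(3) by simp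
  then show "\<delta> C E = s" using d s by (simp add: mult_generator_eq_iff) (metis generator_inv inv_inv)
qed

lemma panel_type_eq_iff_opposite:
  assumes C: "C \<in> \<Delta> \<epsilon>" and D: "D \<in> \<Delta> \<epsilon>" and X: "X \<in> \<Delta> (opp_sign \<epsilon>)" and Y: "Y \<in> \<Delta> (opp_sign \<epsilon>)"
    and s: "s \<in> S" and CD: "\<delta> C D = s" and t: "t \<in> S" and XY: "\<delta> X Y = t" and CX: "\<delta>s C X = \<one>"
  shows "s = t \<longleftrightarrow> (\<forall>B \<in> \<Delta> \<epsilon>. \<delta> C B = s \<longrightarrow> \<delta>s B X = \<one> \<or> \<delta>s B Y = \<one>)"
proof
  assume "s = t"
  have "\<delta>s B X = \<one> \<or> \<delta>s B Y = \<one>" if B: "B \<in> \<Delta> \<epsilon>" "\<delta> C B = s" for B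
  proof -
    have "\<delta>s B X \<in> {\<one>, s}" using codist_step_left[OF C B(1) X s B(2)] CX s by simp
    moreover have "\<delta>s B Y = \<one>" if "\<delta>s B X = s"
      using codist_descent[OF B(1) X Y XY] that s \<open>s = t\<close> by (simp add: left_descents_generator)
    ultimately show ?thesis by blast
  qed
  then show "\<forall>B \<in> \<Delta> \<epsilon>. \<delta> C B = s \<longrightarrow> \<delta>s B X = \<one> \<or> \<delta>s B Y = \<one>" by blast
next
  assume opp: "\<forall>B \<in> \<Delta> \<epsilon>. \<delta> C B = s \<longrightarrow> \<delta>s B X = \<one> \<or> \<delta>s B Y = \<one>"
  obtain B where B: "B \<in> \<Delta> \<epsilon>" "\<delta> C B = s" "\<delta>s B X = \<delta>s C X \<otimes> s" using Tw3_left[OF C X s] .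
  then have BX: "\<delta>s B X = s" using CX s by simp
  then have "\<delta>s B Y = \<one>" using opp B(1,2) generator_neq_one[OF s] by auto
  then have "t \<otimes> s = \<one>" using codist_step[OF B(1) X Y t XY] BX generator_neq_one[OF s] by auto
  then show "s = t" using s t by (simp add: generator_mult_eq_iff)
qed

end

locale thick_twin_building = twin_building W S \<Delta> \<delta> \<delta>s
  for W :: "('w, 'm) monoid_scheme" (structure) and S
    and \<Delta> :: "sign \<Rightarrow> 'c set" and \<delta> and \<delta>s +
  assumes thick: "thick W S \<Delta> \<delta>"
begin

lemma third_chamber_exists:
  assumes "C \<in> \<Delta> \<epsilon>" "s \<in> S"
  obtains D where "D \<in> \<Delta> \<epsilon>" "\<delta> C D = s" "D \<noteq> B"
proof -
  let ?P = "residue \<epsilon> {s} C"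
  have P: "D \<in> \<Delta> \<epsilon> \<and> (D = C \<or> \<delta> C D = s)" if "D \<in> ?P" for D
    using that parabolic_singleton[OF assms(2)] half.WD1[OF assms(1)] unfolding residue_def by blast
  have "\<not> ?P \<subseteq> {C, B}"
  proof
    assume sub: "?P \<subseteq> {C, B}"
    have "infinite ?P \<or> 3 \<le> card ?P"
      using thick residue_of_type_residue[OF assms(1)] assms(2) unfolding thick_def by blast
    moreover have "finite ?P" using sub finite_subset by blast
    moreover have "card ?P \<le> card {C, B}" using sub by (intro card_mono) auto
    moreover have "card {C, B} \<le> 2" by (simp add: card_insert_if)
    ultimately show False by linarith
  qed
  then show thesis using P that by blast
qed

lemma codist_stationary_exists:
  assumes C: "C \<in> \<Delta> \<epsilon>" and D: "D \<in> \<Delta> (opp_sign \<epsilon>)" and s: "s \<in> S" "s \<notin> left_descents (\<delta>s C D)"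
  obtains E where "E \<in> \<Delta> (opp_sign \<epsilon>)" "\<delta> D E = s" "\<delta>s C E = \<delta>s C D"
proof -
  have w: "\<delta>s C D \<in> carrier W" using codist_closed C D by blast
  obtain B where B: "B \<in> \<Delta> (opp_sign \<epsilon>)" "\<delta> D B = s" "\<delta>s C B = s \<otimes> \<delta>s C D"
    using Tw3[OF C D s(1)] by blast
  obtain E where E: "E \<in> \<Delta> (opp_sign \<epsilon>)" "\<delta> D E = s" "E \<noteq> B" using third_chamber_exists[OF D s(1)] .
  have "\<delta> B E = s" using half.panel_trans[OF D B(1) E(1) s(1) B(2) E(2)] E(3) by blast
  moreover have "s \<in> left_descents (\<delta>s C B)"
    using B(3) s w by (simp add: left_descents_generator_mult)
  ultimately have "\<delta>s C E = s \<otimes> \<delta>s C B" using codist_descent[OF C B(1) E(1)] by blast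
  then show thesis using that E B(3) s w by simp
qed

lemma codist_stationary_left_exists:
  assumes C: "C \<in> \<Delta> \<epsilon>" and D: "D \<in> \<Delta> (opp_sign \<epsilon>)" and s: "s \<in> S" "s \<notin> right_descents (\<delta>s C D)"
  obtains B where "B \<in> \<Delta> \<epsilon>" "\<delta> C B = s" "\<delta>s B D = \<delta>s C D"
proof -
  have "s \<notin> left_descents (\<delta>s D C)"
    using Tw1[OF C D] codist_closed[OF C D] s(2) by (simp add: left_descents_inv)
  then obtain B where B: "B \<in> \<Delta> \<epsilon>" "\<delta> C B = s" "\<delta>s D B = \<delta>s D C"
    using codist_stationary_exists[of D "opp_sign \<epsilon>" C s] C D s(1) by auto
  then have "\<delta>s B D = \<delta>s C D"
    using Tw1[of D "opp_sign \<epsilon>" B] Tw1[OF C D] codist_closed[OF C D] D by simp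
  then show thesis using that B by blast
qed

lemma common_opposite_exists:
  assumes C: "C \<in> \<Delta> \<epsilon>" and E: "E \<in> \<Delta> \<epsilon>" and r: "r \<in> S" and CE: "\<delta> C E = r"
  shows "\<exists>X \<in> \<Delta> (opp_sign \<epsilon>). \<delta>s C X = \<one> \<and> \<delta>s E X = \<one>"
proof -
  obtain X where X: "X \<in> \<Delta> (opp_sign \<epsilon>)" "\<delta>s C X = \<one>" using codist_attained[OF C] by blast
  consider "\<delta>s E X = \<one>" | "\<delta>s E X = r" using codist_step_left[OF C E X(1) r CE] X(2) r by auto
  then show ?thesis
  proof cases
    case 1
    then show ?thesis using X by blast
  next
    case 2
    have "r \<notin> left_descents (\<delta>s C X)" by (simp add: X(2) left_descents_def)
    then obtain Z where Z: "Z \<in> \<Delta> (opp_sign \<epsilon>)" "\<delta> X Z = r" "\<delta>s C Z = \<one>"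
      using codist_stationary_exists[OF C X(1) r] X(2) by metis
    then have "\<delta>s E Z = r \<otimes> r"
      using codist_descent[OF E X(1) Z(1,2)] 2 r by (simp add: left_descents_generator)
    then show ?thesis using Z r by auto
  qed
qed

text \<open>
  For \<open>w = \<delta>s C X\<close>, choose \<open>D\<close> with \<open>\<delta>s D X = w\<close> if \<open>s\<close> is an ascent of \<open>w\<close>; otherwise every \<open>D\<close> in the
  \<open>s\<close>-panel of \<open>C\<close> works.
\<close>

lemma shorter_codist_exists:
  assumes C: "C \<in> \<Delta> \<epsilon>" and X: "X \<in> \<Delta> (opp_sign \<epsilon>)" and s: "s \<in> S"
    and f: "\<forall>D \<in> \<Delta> \<epsilon>. \<delta> C D = s \<longrightarrow> f D \<in> \<Delta> (opp_sign \<epsilon>) \<and> \<delta> X (f D) = t"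
    and descent: "t \<in> left_descents (\<delta>s C X)" and neq: "t \<otimes> \<delta>s C X \<noteq> \<delta>s C X \<otimes> s"
  shows "\<exists>D \<in> \<Delta> \<epsilon>. \<delta> C D = s \<and> \<ell> (\<delta>s D (f D)) < \<ell> (\<delta>s C X)"
proof -
  define w where "w = \<delta>s C X"
  have w: "w \<in> carrier W" unfolding w_def using codist_closed C X by blast
  have t: "t \<in> S" "t \<in> left_descents w" using descent left_descents_subset unfolding w_def by auto
  have tw: "\<ell> (t \<otimes> w) < \<ell> w" using t(2) unfolding left_descents_def by blast
  show ?thesis
  proof (cases "s \<in> right_descents w")
    case False
    obtain D where D: "D \<in> \<Delta> \<epsilon>" "\<delta> C D = s" "\<delta>s D X = w"
      using codist_stationary_left_exists[OF C X s False[unfolded w_def], folded w_def] .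
    then have "\<delta>s D (f D) = t \<otimes> w" using codist_descent[OF D(1) X] f D(1,2) t(2) by simp
    then show ?thesis using D tw unfolding w_def by (intro bexI[of _ D]) simp_all
  next
    case True
    have tws: "s \<in> right_descents (t \<otimes> w)"
      using right_descent_of_left_descent[OF t(2) True w] neq unfolding w_def .
    obtain D where D: "D \<in> \<Delta> \<epsilon>" "\<delta> C D = s" using third_chamber_exists[OF C s] .
    have fD: "f D \<in> \<Delta> (opp_sign \<epsilon>)" "\<delta> X (f D) = t" using f D by auto
    have "\<delta>s C (f D) = t \<otimes> w" using codist_descent[OF C X fD descent] unfolding w_def .
    then have "\<delta>s D (f D) = t \<otimes> w \<otimes> s" using codist_descent_left[OF C D(1) fD(1) D(2)] tws by simp
    moreover have "\<ell> (t \<otimes> w \<otimes> s) < \<ell> w" using tws tw unfolding right_descents_def by simp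
    ultimately show ?thesis using D unfolding w_def by (intro bexI[of _ D]) simp_all
  qed
qed

lemma shorter_codist_left_exists:
  assumes C: "C \<in> \<Delta> \<epsilon>" and X: "X \<in> \<Delta> (opp_sign \<epsilon>)" and t: "t \<in> S"
    and f: "\<forall>E \<in> \<Delta> (opp_sign \<epsilon>). \<delta> X E = t \<longrightarrow> f E \<in> \<Delta> \<epsilon> \<and> \<delta> C (f E) = s"
    and descent: "s \<in> right_descents (\<delta>s C X)" and neq: "t \<otimes> \<delta>s C X \<noteq> \<delta>s C X \<otimes> s"
  shows "\<exists>E \<in> \<Delta> (opp_sign \<epsilon>). \<delta> X E = t \<and> \<ell> (\<delta>s (f E) E) < \<ell> (\<delta>s C X)"
proof -
  let ?w = "\<delta>s C X"
  have w: "?w \<in> carrier W" by (rule codist_closed[OF C X])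
  have XC: "\<delta>s X C = inv ?w" by (rule Tw1[OF C X])
  have s: "s \<in> S" using descent right_descents_subset by blast
  have "s \<otimes> \<delta>s X C \<noteq> \<delta>s X C \<otimes> t"
  proof
    assume "s \<otimes> \<delta>s X C = \<delta>s X C \<otimes> t"
    then have "?w \<otimes> (s \<otimes> inv ?w) \<otimes> ?w = ?w \<otimes> (inv ?w \<otimes> t) \<otimes> ?w" unfolding XC by simp
    then show False using neq s t w by (simp add: m_assoc)
  qed
  moreover have "s \<in> left_descents (\<delta>s X C)" using descent w by (simp add: XC left_descents_inv)
  moreover have "C \<in> \<Delta> (opp_sign (opp_sign \<epsilon>))"
    "\<forall>E \<in> \<Delta> (opp_sign \<epsilon>). \<delta> X E = t \<longrightarrow> f E \<in> \<Delta> (opp_sign (opp_sign \<epsilon>)) \<and> \<delta> C (f E) = s"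
    using C f by simp_all
  ultimately obtain E where E: "E \<in> \<Delta> (opp_sign \<epsilon>)" "\<delta> X E = t" "\<ell> (\<delta>s E (f E)) < \<ell> (\<delta>s X C)"
    using shorter_codist_exists[OF X _ t] by blast
  then have fE: "f E \<in> \<Delta> \<epsilon>" using f by blast
  have "\<ell> (\<delta>s E (f E)) = \<ell> (\<delta>s (f E) E)"
    using Tw1[OF fE E(1)] cox_length_inv[OF codist_closed[OF fE E(1)]] by simp
  then show ?thesis using E w by (intro bexI[of _ E]) (simp_all add: XC cox_length_inv)
qed

end

section \<open>Automorphisms\<close>

locale twin_building_automorphism = twin_building W S \<Delta> \<delta> \<delta>s
  for W :: "('w, 'm) monoid_scheme" (structure) and S
    and \<Delta> :: "sign \<Rightarrow> 'c set" and \<delta> and \<delta>s +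
  fixes \<theta> :: "'c \<Rightarrow> 'c" and \<tau> :: "sign \<Rightarrow> sign"
  assumes automorphism: "twin_automorphism W S \<Delta> \<delta> \<delta>s \<theta>"
    and image_half: "\<theta> ` \<Delta> \<epsilon> = \<Delta> (\<tau> \<epsilon>)"
    and opp_sign_commutes: "\<tau> (opp_sign \<epsilon>) = opp_sign (\<tau> \<epsilon>)"
begin

lemma aut_closed [simp]: "C \<in> \<Delta> \<epsilon> \<Longrightarrow> \<theta> C \<in> \<Delta> (\<tau> \<epsilon>)"
  using image_half by blast

lemma aut_closed_opp [simp]: "C \<in> \<Delta> (opp_sign \<epsilon>) \<Longrightarrow> \<theta> C \<in> \<Delta> (opp_sign (\<tau> \<epsilon>))"
  using aut_closed[of C "opp_sign \<epsilon>"] by (simp add: opp_sign_commutes)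

lemma aut_inj_on: "inj_on \<theta> (\<Delta> \<epsilon>)"
proof -
  have "inj_on \<theta> (\<Union>\<epsilon>. \<Delta> \<epsilon>)" using automorphism unfolding twin_automorphism_def bij_betw_def by blast
  then show ?thesis by (rule inj_on_subset) blast
qed

definition aut_inv :: "sign \<Rightarrow> 'c \<Rightarrow> 'c" where
  "aut_inv \<epsilon> = inv_into (\<Delta> \<epsilon>) \<theta>"

lemma aut_inv_closed: "D \<in> \<Delta> (\<tau> \<epsilon>) \<Longrightarrow> aut_inv \<epsilon> D \<in> \<Delta> \<epsilon>"
  unfolding aut_inv_def by (rule inv_into_into) (simp add: image_half)

lemma aut_aut_inv: "D \<in> \<Delta> (\<tau> \<epsilon>) \<Longrightarrow> \<theta> (aut_inv \<epsilon> D) = D"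
  unfolding aut_inv_def by (rule f_inv_into_f) (simp add: image_half)

lemma aut_inv_aut: "C \<in> \<Delta> \<epsilon> \<Longrightarrow> aut_inv \<epsilon> (\<theta> C) = C"
  unfolding aut_inv_def by (rule inv_into_f_f[OF aut_inj_on])

lemma aut_adjacent: "C \<in> \<Delta> \<epsilon> \<Longrightarrow> D \<in> \<Delta> \<epsilon> \<Longrightarrow> \<delta> C D \<in> S \<Longrightarrow> \<delta> (\<theta> C) (\<theta> D) \<in> S"
  using automorphism unfolding twin_automorphism_def adjacent_def by blast

lemma aut_opposite_iff:
  assumes "C \<in> \<Delta> \<epsilon>" "D \<in> \<Delta> (opp_sign \<epsilon>)"
  shows "\<delta>s (\<theta> C) (\<theta> D) = \<one> \<longleftrightarrow> \<delta>s C D = \<one>"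
proof -
  have "opposite W \<Delta> \<delta>s C D \<longleftrightarrow> opposite W \<Delta> \<delta>s (\<theta> C) (\<theta> D)"
    using automorphism assms unfolding twin_automorphism_def by blast
  moreover have "opposite W \<Delta> \<delta>s C D \<longleftrightarrow> \<delta>s C D = \<one>"
    using assms unfolding opposite_def by blast
  moreover have "opposite W \<Delta> \<delta>s (\<theta> C) (\<theta> D) \<longleftrightarrow> \<delta>s (\<theta> C) (\<theta> D) = \<one>"
    using aut_closed[OF assms(1)] aut_closed_opp[OF assms(2)] unfolding opposite_def by blast
  ultimately show ?thesis by simp
qed

lemma aut_dist_eq_iff:
  assumes C: "C \<in> \<Delta> \<epsilon>" and D: "D \<in> \<Delta> \<epsilon>" and E: "E \<in> \<Delta> \<epsilon>" and CD: "\<delta> C D \<in> S"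
  shows "\<delta> (\<theta> C) (\<theta> E) = \<delta> (\<theta> C) (\<theta> D) \<longleftrightarrow> \<delta> C E = \<delta> C D"
proof (cases "C = E")
  case True
  have "\<delta> (\<theta> C) (\<theta> D) \<in> S" using aut_adjacent C D CD by blast
  then show ?thesis using True CD C generator_neq_one by (metis aut_closed half.dist_self)
next
  case False
  then have neq: "\<theta> C \<noteq> \<theta> E" using inj_on_eq_iff[OF aut_inj_on C E] by simp
  have "\<delta> (\<theta> C) (\<theta> E) = \<delta> (\<theta> C) (\<theta> D) \<longleftrightarrow>
      (\<forall>Z \<in> \<theta> ` \<Delta> (opp_sign \<epsilon>). \<delta>s (\<theta> E) Z = \<one> \<longrightarrow> \<delta>s (\<theta> C) Z = \<one> \<or> \<delta>s (\<theta> D) Z = \<one>)"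
    using dist_eq_iff_opposite[OF aut_closed[OF C] aut_closed[OF D] aut_closed[OF E]
        aut_adjacent[OF C D CD] HOL.refl neq]
    by (simp only: image_half opp_sign_commutes)
  also have "\<dots> \<longleftrightarrow> (\<forall>Z \<in> \<Delta> (opp_sign \<epsilon>). \<delta>s E Z = \<one> \<longrightarrow> \<delta>s C Z = \<one> \<or> \<delta>s D Z = \<one>)"
    using aut_opposite_iff C D E by simp
  also have "\<dots> \<longleftrightarrow> \<delta> C E = \<delta> C D"
    using dist_eq_iff_opposite[OF C D E CD HOL.refl False] by simp
  finally show ?thesis .
qed

lemma aut_opposite_type_eq:
  assumes C: "C \<in> \<Delta> \<epsilon>" and D: "D \<in> \<Delta> \<epsilon>" and X: "X \<in> \<Delta> (opp_sign \<epsilon>)" and Y: "Y \<in> \<Delta> (opp_sign \<epsilon>)"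
    and CD: "\<delta> C D \<in> S" and XY: "\<delta> X Y = \<delta> C D" and CX: "\<delta>s C X = \<one>"
  shows "\<delta> (\<theta> C) (\<theta> D) = \<delta> (\<theta> X) (\<theta> Y)"
proof -
  have "\<forall>B \<in> \<Delta> \<epsilon>. \<delta> C B = \<delta> C D \<longrightarrow> \<delta>s B X = \<one> \<or> \<delta>s B Y = \<one>"
    using panel_type_eq_iff_opposite[OF C D X Y CD HOL.refl CD XY CX] by simp
  then have "\<forall>B \<in> \<theta> ` \<Delta> \<epsilon>. \<delta> (\<theta> C) B = \<delta> (\<theta> C) (\<theta> D) \<longrightarrow> \<delta>s B (\<theta> X) = \<one> \<or> \<delta>s B (\<theta> Y) = \<one>"
    using aut_dist_eq_iff[OF C D _ CD] aut_opposite_iff X Y by simp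
  moreover have "\<delta>s (\<theta> C) (\<theta> X) = \<one>" using aut_opposite_iff[OF C X] CX by simp
  moreover have "\<delta> (\<theta> X) (\<theta> Y) \<in> S" using aut_adjacent[OF X Y] XY CD by simp
  ultimately show ?thesis
    using panel_type_eq_iff_opposite[OF aut_closed[OF C] aut_closed[OF D] aut_closed_opp[OF X]
      aut_closed_opp[OF Y] aut_adjacent[OF C D CD]] image_half by simp
qed

lemma aut_image_residue:
  assumes K: "K \<subseteq> S" and \<sigma>: "\<sigma> ` K \<subseteq> S" and C: "C \<in> \<Delta> \<epsilon>"
    and type: "\<And>C D s. C \<in> \<Delta> \<epsilon> \<Longrightarrow> D \<in> \<Delta> \<epsilon> \<Longrightarrow> s \<in> S \<Longrightarrow> \<delta> C D = s \<longleftrightarrow> \<delta> (\<theta> C) (\<theta> D) = \<sigma> s"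
  shows "\<theta> ` residue \<epsilon> K C = residue (\<tau> \<epsilon>) (\<sigma> ` K) (\<theta> C)"
proof
  show "\<theta> ` residue \<epsilon> K C \<subseteq> residue (\<tau> \<epsilon>) (\<sigma> ` K) (\<theta> C)"
  proof (rule residue_image_subset[OF K \<sigma> C aut_closed])
    fix A B assume "A \<in> \<Delta> \<epsilon>" "B \<in> \<Delta> \<epsilon>" "\<delta> A B \<in> K"
    then show "\<delta> (\<theta> A) (\<theta> B) \<in> \<sigma> ` K" using type[of A B "\<delta> A B"] K by auto
  qed
  have "aut_inv \<epsilon> ` residue (\<tau> \<epsilon>) (\<sigma> ` K) (\<theta> C) \<subseteq> residue \<epsilon> K (aut_inv \<epsilon> (\<theta> C))"
  proof (rule residue_image_subset[OF \<sigma> K aut_closed[OF C] aut_inv_closed])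
    fix A B assume A: "A \<in> \<Delta> (\<tau> \<epsilon>)" and B: "B \<in> \<Delta> (\<tau> \<epsilon>)" and "\<delta> A B \<in> \<sigma> ` K"
    then obtain s where s: "s \<in> K" "\<delta> A B = \<sigma> s" by blast
    then have "\<delta> (aut_inv \<epsilon> A) (aut_inv \<epsilon> B) = s"
      using type[OF aut_inv_closed[OF A] aut_inv_closed[OF B], of s] A B K
      by (auto simp: aut_aut_inv)
    then show "\<delta> (aut_inv \<epsilon> A) (aut_inv \<epsilon> B) \<in> K" using s(1) by simp
  qed
  then have inv_image: "aut_inv \<epsilon> ` residue (\<tau> \<epsilon>) (\<sigma> ` K) (\<theta> C) \<subseteq> residue \<epsilon> K C"
    using C by (simp add: aut_inv_aut)
  show "residue (\<tau> \<epsilon>) (\<sigma> ` K) (\<theta> C) \<subseteq> \<theta> ` residue \<epsilon> K C"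
  proof
    fix D assume D: "D \<in> residue (\<tau> \<epsilon>) (\<sigma> ` K) (\<theta> C)"
    then have "\<theta> (aut_inv \<epsilon> D) = D" unfolding residue_def by (simp add: aut_aut_inv)
    then show "D \<in> \<theta> ` residue \<epsilon> K C" using D inv_image by (metis image_eqI image_subset_iff)
  qed
qed

end

locale thick_twin_building_automorphism =
  thick_twin_building W S \<Delta> \<delta> \<delta>s + twin_building_automorphism W S \<Delta> \<delta> \<delta>s \<theta> \<tau>
  for W :: "('w, 'm) monoid_scheme" (structure) and S
    and \<Delta> :: "sign \<Rightarrow> 'c set" and \<delta> and \<delta>s and \<theta> and \<tau>
begin

lemma aut_type_eq:
  assumes C: "C \<in> \<Delta> \<epsilon>" and E: "E \<in> \<Delta> \<epsilon>" and s: "s \<in> S"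
    and D: "D \<in> \<Delta> \<epsilon>" "\<delta> C D = s" and F: "F \<in> \<Delta> \<epsilon>" "\<delta> E F = s"
  shows "\<delta> (\<theta> C) (\<theta> D) = \<delta> (\<theta> E) (\<theta> F)"
proof -
  have "\<delta> C E \<in> parabolic S" using C E S_generates half.dist_closed by blast
  from subset_refl C E this D show ?thesis
  proof (induction arbitrary: D rule: half.gallery_induct)
    case base
    then show ?case using aut_dist_eq_iff[OF E F(1)] F(2) s by simp
  next
    case (step A B r)
    obtain X where X: "X \<in> \<Delta> (opp_sign \<epsilon>)" "\<delta>s A X = \<one>" "\<delta>s B X = \<one>"
      using common_opposite_exists[OF step(1-4)] by blast
    obtain Y where Y: "Y \<in> \<Delta> (opp_sign \<epsilon>)" "\<delta> X Y = s" using third_chamber_exists[OF X(1) s] .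
    obtain G where G: "G \<in> \<Delta> \<epsilon>" "\<delta> B G = s" using third_chamber_exists[OF step(2) s] .
    have "\<delta> (\<theta> A) (\<theta> D) = \<delta> (\<theta> X) (\<theta> Y)"
      using aut_opposite_type_eq[OF step(1,6) X(1) Y(1)] s step(7) Y(2) X(2) by simp
    also have "\<dots> = \<delta> (\<theta> B) (\<theta> G)"
      using aut_opposite_type_eq[OF step(2) G(1) X(1) Y(1)] s G(2) Y(2) X(3) by simp
    finally show ?case using step(5)[OF G] by simp
  qed
qed

lemma type_permutation_exists:
  assumes "finite S"
  obtains \<sigma> where "\<sigma> ` S = S"
    "\<And>C D s. C \<in> \<Delta> \<epsilon> \<Longrightarrow> D \<in> \<Delta> \<epsilon> \<Longrightarrow> s \<in> S \<Longrightarrow> \<delta> C D = s \<longleftrightarrow> \<delta> (\<theta> C) (\<theta> D) = \<sigma> s"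
proof -
  obtain C where C: "C \<in> \<Delta> \<epsilon>" using half.nonempty by blast
  have "\<forall>s \<in> S. \<exists>D. D \<in> \<Delta> \<epsilon> \<and> \<delta> C D = s" using third_chamber_exists[OF C] by metis
  then obtain f where f: "f s \<in> \<Delta> \<epsilon>" "\<delta> C (f s) = s" if "s \<in> S" for s by metis
  define \<sigma> where "\<sigma> s = \<delta> (\<theta> C) (\<theta> (f s))" for s
  have type: "\<delta> A B = s \<longleftrightarrow> \<delta> (\<theta> A) (\<theta> B) = \<sigma> s" if A: "A \<in> \<Delta> \<epsilon>" "B \<in> \<Delta> \<epsilon>" "s \<in> S" for A B s
  proof -
    obtain D where D: "D \<in> \<Delta> \<epsilon>" "\<delta> A D = s" using third_chamber_exists[OF A(1,3)] .
    then have "\<delta> (\<theta> A) (\<theta> D) = \<sigma> s"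
      unfolding \<sigma>_def using aut_type_eq[OF A(1) C A(3)] f A(3) by blast
    then show ?thesis using aut_dist_eq_iff[OF A(1) D(1) A(2)] D(2) A(3) by auto
  qed
  have "\<sigma> ` S \<subseteq> S" unfolding \<sigma>_def using aut_adjacent[OF C] f by auto
  moreover have "inj_on \<sigma> S"
  proof (rule inj_onI)
    fix s t assume st: "s \<in> S" "t \<in> S" "\<sigma> s = \<sigma> t"
    then have "\<delta> C (f s) = t" using type[OF C f(1)[OF st(1)] st(2)] by (simp add: \<sigma>_def)
    then show "s = t" using f st by simp
  qed
  ultimately have "\<sigma> ` S = S" using assms endo_inj_surj by blast
  then show thesis using that type by blast
qed

end

locale half_swapping_automorphism = thick_twin_building_automorphism W S \<Delta> \<delta> \<delta>s \<theta> opp_sign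
  for W :: "('w, 'm) monoid_scheme" (structure) and S
    and \<Delta> :: "sign \<Rightarrow> 'c set" and \<delta> and \<delta>s and \<theta>
begin

lemma minimal_chamber_twisted_descent:
  assumes C: "C \<in> \<Delta> \<epsilon>" and s: "s \<in> S" and t: "t \<in> S"
    and type: "\<And>D. D \<in> \<Delta> \<epsilon> \<Longrightarrow> \<delta> C D = s \<longleftrightarrow> \<delta> (\<theta> C) (\<theta> D) = t"
    and min: "\<And>D. D \<in> \<Delta> \<epsilon> \<Longrightarrow> \<ell> (\<delta>s C (\<theta> C)) \<le> \<ell> (\<delta>s D (\<theta> D))"
    and descent: "t \<in> left_descents (\<delta>s C (\<theta> C)) \<or> s \<in> right_descents (\<delta>s C (\<theta> C))"
  shows "t \<otimes> \<delta>s C (\<theta> C) = \<delta>s C (\<theta> C) \<otimes> s"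
proof (rule ccontr)
  let ?w = "\<delta>s C (\<theta> C)"
  assume neq: "t \<otimes> ?w \<noteq> ?w \<otimes> s"
  have \<theta>C: "\<theta> C \<in> \<Delta> (opp_sign \<epsilon>)" using C by (rule aut_closed)
  have w: "?w \<in> carrier W" using C \<theta>C by (rule codist_closed)
  from descent show False
  proof
    assume t_descent: "t \<in> left_descents ?w"
    have "\<forall>D \<in> \<Delta> \<epsilon>. \<delta> C D = s \<longrightarrow> \<theta> D \<in> \<Delta> (opp_sign \<epsilon>) \<and> \<delta> (\<theta> C) (\<theta> D) = t"
      using aut_closed type by blast
    from shorter_codist_exists[OF C \<theta>C s this t_descent neq]
    obtain D where "D \<in> \<Delta> \<epsilon>" "\<ell> (\<delta>s D (\<theta> D)) < \<ell> ?w" by blast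
    then show False using min[of D] by simp
  next
    assume s_descent: "s \<in> right_descents ?w"
    let ?f = "aut_inv \<epsilon>"
    have f: "?f E \<in> \<Delta> \<epsilon>" "\<theta> (?f E) = E" if "E \<in> \<Delta> (opp_sign \<epsilon>)" for E
      using that by (rule aut_inv_closed, rule aut_aut_inv)
    have "\<forall>E \<in> \<Delta> (opp_sign \<epsilon>). \<delta> (\<theta> C) E = t \<longrightarrow> ?f E \<in> \<Delta> \<epsilon> \<and> \<delta> C (?f E) = s"
      using type[OF f(1)] f by simp
    from shorter_codist_left_exists[OF C \<theta>C t this s_descent neq]
    obtain E where "E \<in> \<Delta> (opp_sign \<epsilon>)" "\<ell> (\<delta>s (?f E) E) < \<ell> ?w" by blast
    then show False using min[OF f(1)] f(2) by (metis not_less)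
  qed
qed

lemma descents_at_minimal_chamber:
  assumes C: "C \<in> \<Delta> \<epsilon>" and min: "\<And>D. D \<in> \<Delta> \<epsilon> \<Longrightarrow> \<ell> (\<delta>s C (\<theta> C)) \<le> \<ell> (\<delta>s D (\<theta> D))"
    and \<sigma>: "\<sigma> ` S = S"
    and type: "\<And>C D s. C \<in> \<Delta> \<epsilon> \<Longrightarrow> D \<in> \<Delta> \<epsilon> \<Longrightarrow> s \<in> S \<Longrightarrow> \<delta> C D = s \<longleftrightarrow> \<delta> (\<theta> C) (\<theta> D) = \<sigma> s"
  defines "w \<equiv> \<delta>s C (\<theta> C)"
  shows "left_descents w = \<sigma> ` right_descents w"
    and "\<forall>s \<in> right_descents w. w \<otimes> s \<otimes> inv w = \<sigma> s"
proof -
  have w: "w \<in> carrier W" unfolding w_def by (rule codist_closed[OF C aut_closed[OF C]])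
  have twist: "\<sigma> s \<otimes> w = w \<otimes> s" if "s \<in> S" "\<sigma> s \<in> left_descents w \<or> s \<in> right_descents w" for s
    using minimal_chamber_twisted_descent[OF C that(1) _ type[OF C _ that(1)] min] that \<sigma>
    unfolding w_def by blast
  have iff: "\<sigma> s \<in> left_descents w \<longleftrightarrow> s \<in> right_descents w" if "s \<in> S" for s
  proof -
    have "\<sigma> s \<in> S" using that \<sigma> by blast
    then show ?thesis
      using that twist[OF that] unfolding left_descents_def right_descents_def by auto
  qed
  show "left_descents w = \<sigma> ` right_descents w"
  proof
    show "left_descents w \<subseteq> \<sigma> ` right_descents w"
    proof
      fix t assume t: "t \<in> left_descents w"
      then obtain s where "s \<in> S" "t = \<sigma> s" using left_descents_subset[of w] \<sigma> by blast
      then show "t \<in> \<sigma> ` right_descents w" using t iff by blast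
    qed
    show "\<sigma> ` right_descents w \<subseteq> left_descents w" using iff right_descents_subset[of w] by blast
  qed
  show "\<forall>s \<in> right_descents w. w \<otimes> s \<otimes> inv w = \<sigma> s"
  proof
    fix s assume s: "s \<in> right_descents w"
    then have "s \<in> S" "\<sigma> s \<in> S" using right_descents_subset[of w] \<sigma> by auto
    moreover from this have "w \<otimes> s = \<sigma> s \<otimes> w" using twist s by simp
    ultimately show "w \<otimes> s \<otimes> inv w = \<sigma> s" using w by (simp add: m_assoc)
  qed
qed

lemma opposite_residue_at_minimal_chamber:
  assumes finite: "finite S" and C: "C \<in> \<Delta> \<epsilon>"
    and min: "\<And>D. D \<in> \<Delta> \<epsilon> \<Longrightarrow> \<ell> (\<delta>s C (\<theta> C)) \<le> \<ell> (\<delta>s D (\<theta> D))"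
  defines "J \<equiv> right_descents (\<delta>s C (\<theta> C))"
  shows "finite (parabolic J)"
    and "opposite_residues W S \<Delta> \<delta> \<delta>s (\<theta> ` residue \<epsilon> J C) (residue \<epsilon> J C)"
proof -
  define w where "w = \<delta>s C (\<theta> C)"
  have \<theta>C: "\<theta> C \<in> \<Delta> (opp_sign \<epsilon>)" using C by (rule aut_closed)
  have w: "w \<in> carrier W" unfolding w_def by (rule codist_closed[OF C \<theta>C])
  obtain \<sigma> where \<sigma>: "\<sigma> ` S = S"
    and type: "\<And>C D s. C \<in> \<Delta> \<epsilon> \<Longrightarrow> D \<in> \<Delta> \<epsilon> \<Longrightarrow> s \<in> S \<Longrightarrow> \<delta> C D = s \<longleftrightarrow> \<delta> (\<theta> C) (\<theta> D) = \<sigma> s"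
    by (rule type_permutation_exists[OF finite, of \<epsilon>]) metis
  have descents: "left_descents w = \<sigma> ` right_descents w"
    unfolding w_def by (rule descents_at_minimal_chamber(1)[OF C min \<sigma> type])
  have "\<forall>s \<in> right_descents w. w \<otimes> s \<otimes> inv w = \<sigma> s"
    unfolding w_def by (rule descents_at_minimal_chamber(2)[OF C min \<sigma> type])
  then have conj: "(\<lambda>s. w \<otimes> s \<otimes> inv w) ` right_descents w = left_descents w"
    unfolding descents by simp
  have J: "left_descents w = J" "w \<in> parabolic J"
    unfolding J_def w_def[symmetric]
    by (rule left_descents_eq_right_descents_if_conj[OF w conj],
      rule mem_parabolic_right_descents_if_conj[OF w conj])
  then have "\<sigma> ` J = J" using descents by (simp add: J_def w_def)
  moreover have JS: "J \<subseteq> S" unfolding J_def by (rule right_descents_subset)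
  ultimately have "\<theta> ` residue \<epsilon> J C = residue (opp_sign \<epsilon>) J (\<theta> C)"
    using aut_image_residue[OF JS _ C type] by simp
  then show "opposite_residues W S \<Delta> \<delta> \<delta>s (\<theta> ` residue \<epsilon> J C) (residue \<epsilon> J C)"
    using opposite_residues_if_codist_in_parabolic[OF JS C \<theta>C] J(2) unfolding w_def by simp
  show "finite (parabolic J)" using finite_parabolic_left_descents[OF finite w] J(1) by simp
qed

end

theorem proposition1p1:
  fixes W :: "('w, 'm) monoid_scheme"
    and S :: "'w set"
    and \<Delta> :: "sign \<Rightarrow> 'c set"
    and \<delta> \<delta>s :: "'c \<Rightarrow> 'c \<Rightarrow> 'w"
    and \<theta> :: "'c \<Rightarrow> 'c"
  assumes "coxeter_system W S"
    and "finite S"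
    and "irreducible_coxeter W S"
    and "twin_building W S \<Delta> \<delta> \<delta>s"
    and "thick W S \<Delta> \<delta>"
    and "twin_automorphism W S \<Delta> \<delta> \<delta>s \<theta>"
    and "\<theta> ` \<Delta> Plus = \<Delta> Minus"
    and "\<theta> ` \<Delta> Minus = \<Delta> Plus"
  shows "\<exists>R. spherical_residue W S \<Delta> \<delta> R \<and> opposite_residues W S \<Delta> \<delta> \<delta>s (\<theta> ` R) R"
proof -
  interpret twin_building W S \<Delta> \<delta> \<delta>s by fact
  interpret half_swapping_automorphism W S \<Delta> \<delta> \<delta>s \<theta>
  proof
    show "\<theta> ` \<Delta> \<epsilon> = \<Delta> (opp_sign \<epsilon>)" for \<epsilon> using assms(7,8) by (cases \<epsilon>) auto
  qed (fact | rule HOL.refl)+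
  obtain C where C: "C \<in> \<Delta> Plus" and min: "\<And>D. D \<in> \<Delta> Plus \<Longrightarrow> \<ell> (\<delta>s C (\<theta> C)) \<le> \<ell> (\<delta>s D (\<theta> D))"
    using ex_has_least_nat[of "\<lambda>C. C \<in> \<Delta> Plus" _ "\<lambda>C. \<ell> (\<delta>s C (\<theta> C))"] half.nonempty by blast
  let ?J = "right_descents (\<delta>s C (\<theta> C))"
  have "spherical_residue W S \<Delta> \<delta> (residue Plus ?J C)"
    using opposite_residue_at_minimal_chamber(1)[OF assms(2) C min] right_descents_subset
      residue_of_type_residue[OF C] unfolding spherical_residue_def by blast
  moreover have "opposite_residues W S \<Delta> \<delta> \<delta>s (\<theta> ` residue Plus ?J C) (residue Plus ?J C)"
    by (rule opposite_residue_at_minimal_chamber(2)[OF assms(2) C min])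
  ultimately show ?thesis by blast
qed

end
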